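(* Let $p,q\ge0$ be integers with $q$ even, let $\Omega$ be a complex symmetric $p\times p$ matrix with positive definite imaginary part, and let $D$ be a lattice in $\mathbb R^p\times(\mathbb R^p)^*\times\mathbb Z^q\times\mathbb T^q$, the image of $\mathbb Z^{d}$, $d=2p+q$, under an embedding $\Phi$ (see context). Let $\hat\Theta_D=\sqrt{2^p\det(\operatorname{Im}\Omega)}\;{}_D\langle f,f\rangle$ be the quantum theta function obtained from $$f(s,n)=\exp\Big[\pi i\sum_{j,k=1}^ps_j\Omega_{jk}s_k-\frac{\pi}{2}\sum_{i=1}^{q/2}\big(n_i^2+n_{\frac q2+i}^2\big)\Big],\qquad (s,n)\in\mathbb R^p\times\mathbb Z^q .$$ Then for every $g\in D$, $$\hat C_g\; e_{D,\alpha}(g)\;\hat x_g^*(\hat\Theta_D)=\hat\Theta_D,$$ and the consistency condition $$\frac{\hat C_{g+h}}{\hat C_g\hat C_h}=\hat{\mathcal T}_g(h)\,\alpha(g,h)$$ holds, if one assigns $$\hat C_g=\widetilde b_g\,e^{-\frac{\pi}{2}H(\underline{w_g},\underline{w_g})}$$ and defines the (modified) quantum translation $\hat x_g^*$ (linear, acting termwise) by $$\hat x_g^*(e_{D,\alpha}(h))=\hat{\mathcal T}_g(h)\,e_{D,\alpha}(h),\qquad \hat{\mathcal T}_g(h)=\frac{\hat C_{g+h}}{\hat C_g\,\hat C_h\,\alpha(g,h)} .$$ Here, for $g=(w_{g1},w_{g2},m,r)\in D$, $\underline{w_g}=\Omega w_{g1}+w_{g2}$, $H(\underline{w_g},\underline{w_g})=\underline{w_g}^{\,t}(\operatorname{Im}\Omega)^{-1}\overline{\underline{w_g}}$,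 and $$\widetilde b_g=\prod_{j=1}^q e^{-\frac{\pi}{2}m_j^2-\pi i m_jr_j}\,\theta\big(i,\,-r_j+\tfrac{i m_j}{2}\big).$$
   Context: Lattice. $\Phi$ is a real $(2p+2q)\times d$ matrix, $d=2p+q$, whose rows $2p+1,\dots,2p+q$ have integer entries; it embeds $\mathbb Z^d$ in $\mathbb R^p\times(\mathbb R^p)^*\times\mathbb Z^q\times\mathbb T^q$, $\mathbb T=\mathbb R/\mathbb Z$ (the last $q$ coordinates being read mod $1$), with image the lattice $D$. An element $h\in D$ is written $h=(w_{h1},w_{h2},m,r)$ with $w_{h1},w_{h2}\in\mathbb R^p$, $m\in\mathbb Z^q$, and $r\in\mathbb R^q$ the real representative given by $\Phi$. Heisenberg representation. For $h\in D$ and $f$ on $\mathbb R^p\times\mathbb Z^q$, $$\pi_hf(s,n)=e^{2\pi i(w_{h2}\cdot s+r\cdot n)+\pi i(w_{h1}\cdot w_{h2}+m\cdot r)}f(s+w_{h1},n+m).$$ The cocycle $\alpha$ is defined by $\pi_g\pi_h=\alpha(g,h)\pi_{g+h}$; explicitly, for $g=(w_{g1},w_{g2},m,r)$ and $h=(w_{h1},w_{h2},m',r')$, $\alpha(g,h)=e^{\pi i(w_{g1}\cdot w_{h2}-w_{h1}\cdot w_{g2}+m\cdot r'-m'\cdot r)}$. Algebra. $\mathcal S(D)$ is the algebra of series $\sum_{h\in D}a_he_{D,\alpha}(h)$ with rapidly decreasing coefficients, $e_{D,\alpha}(h)$ being the delta function supported at $h$, with multiplication $e_{D,\alpha}(g)e_{D,\alpha}(h)=\alpha(g,h)e_{D,\alpha}(g+h)$.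 Inner product. For Schwartz functions $f_1,f_2$ on $\mathbb R^p\times\mathbb Z^q$, ${}_D\langle f_1,f_2\rangle=\sum_{h\in D}\langle f_1,\pi_hf_2\rangle e_{D,\alpha}(h)$, where $\langle f_1,f_2\rangle=\sum_{n\in\mathbb Z^q}\int_{\mathbb R^p}f_1(s,n)\overline{f_2(s,n)}\,ds$. Classical theta function: $\theta(\tau,z)=\sum_{n\in\mathbb Z}e^{\pi i\tau n^2+2\pi inz}$.
   Formalization: It is additionally assumed that Ĉ_h ≠ 0 for every h in D; otherwise T̂_g(h) has a zero denominator, and the equation fails (e.g. p=0, q=2, m=x, r=(x_1/2, 0), where θ(i, -1/2+i/2)=0 makes Ĉ_h=0 at h=(1,0)). *)

theory Defs
  imports
    "HOL-Analysis.Analysis"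
    "Jordan_Normal_Form.Determinant"
    "Jordan_Normal_Form.Gauss_Jordan_Elimination"
begin

text \<open>
  The dimensions \<open>p\<close> and \<open>q\<close> may be zero, so vectors and matrices are those of
  Jordan_Normal_Form, and their notation replaces that of HOL-Analysis.
\<close>

unbundle no vec_syntax
unbundle no inner_syntax
hide_const (open) Finite_Cartesian_Product.vec Finite_Cartesian_Product.mat
  Finite_Cartesian_Product.row Finite_Cartesian_Product.column Finite_Cartesian_Product.rows
  Determinants.det Finite_Cartesian_Product.transpose

section \<open>Lattices in \<open>\<real>\<^sup>p \<times> (\<real>\<^sup>p)* \<times> \<int>\<^sup>q \<times> (\<real>/\<int>)\<^sup>q\<close>\<close>

text \<open>
  The group \<open>\<real>\<^sup>p \<times> (\<real>\<^sup>p)* \<times> \<int>\<^sup>q \<times> (\<real>/\<int>)\<^sup>q\<close> is realised with complex coordinates: the first \<open>2p\<close> are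
  real, the next \<open>q\<close> are integers, and the last \<open>q\<close> lie on the unit circle, the class of \<open>r\<close>
  modulo 1 being \<open>cis (2 \<pi> r)\<close>. The first \<open>2p + q\<close> coordinates are added, the last \<open>q\<close> multiplied.
\<close>

definition phase_space :: "nat \<Rightarrow> nat \<Rightarrow> (nat \<Rightarrow> complex) topology" where
  "phase_space p q = product_topology
     (\<lambda>i. top_of_set (if i < 2*p then \<real> else if i < 2*p + q then \<int> else sphere 0 1))
     {..<2*p + 2*q}"

definition phase_add :: "nat \<Rightarrow> nat \<Rightarrow> (nat \<Rightarrow> complex) \<Rightarrow> (nat \<Rightarrow> complex) \<Rightarrow> (nat \<Rightarrow> complex)" where
  "phase_add p q u v =
     (\<lambda>i\<in>{..<2*p + 2*q}. if i < 2*p + q then u i + v i else u i * v i)"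

definition phase_pt :: "nat \<Rightarrow> nat \<Rightarrow> real vec \<Rightarrow> (nat \<Rightarrow> complex)" where
  "phase_pt p q h =
     (\<lambda>i\<in>{..<2*p + 2*q}. if i < 2*p + q then of_real (h $ i) else cis (2 * pi * h $ i))"

definition emb :: "real mat \<Rightarrow> int vec \<Rightarrow> real vec" where
  "emb \<Phi> x = \<Phi> *\<^sub>v map_vec real_of_int x"

definition lattice_embedding :: "nat \<Rightarrow> nat \<Rightarrow> real mat \<Rightarrow> bool" where
  "lattice_embedding p q \<Phi> \<longleftrightarrow>
     \<Phi> \<in> carrier_mat (2*p + 2*q) (2*p + q) \<and>
     (\<forall>i\<in>{2*p..<2*p + q}. \<forall>j<2*p + q. \<Phi> $$ (i, j) \<in> \<int>) \<and>
     inj_on (\<lambda>x. phase_pt p q (emb \<Phi> x)) (carrier_vec (2*p + q)) \<and>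
     (let L = (\<lambda>x. phase_pt p q (emb \<Phi> x)) ` carrier_vec (2*p + q)
      in subtopology (phase_space p q) L = discrete_topology L \<and>
         (\<exists>K. compactin (phase_space p q) K \<and>
              topspace (phase_space p q) = {phase_add p q u v | u v. u \<in> L \<and> v \<in> K}))"

text \<open>
  An element of the lattice is stored as the real vector \<open>(w\<^sub>1, w\<^sub>2, m, r)\<close> that \<open>\<Phi>\<close> assigns to it.
  For a lattice embedding this loses nothing: \<open>h\<close> is determined by its class in the group, and the
  sum of representatives is the representative of the sum.
\<close>

definition lat :: "nat \<Rightarrow> nat \<Rightarrow> real mat \<Rightarrow> real vec set" where
  "lat p q \<Phi> = emb \<Phi> ` carrier_vec (2*p + q)"

definition w1 :: "nat \<Rightarrow> real vec \<Rightarrow> real vec" where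
  "w1 p h = vec p (\<lambda>i. h $ i)"

definition w2 :: "nat \<Rightarrow> real vec \<Rightarrow> real vec" where
  "w2 p h = vec p (\<lambda>i. h $ (p + i))"

text \<open>The entries in question are integers for every lattice element; \<open>floor\<close> only changes the type.\<close>

definition mpart :: "nat \<Rightarrow> nat \<Rightarrow> real vec \<Rightarrow> int vec" where
  "mpart p q h = vec q (\<lambda>j. \<lfloor>h $ (2*p + j)\<rfloor>)"

definition rpart :: "nat \<Rightarrow> nat \<Rightarrow> real vec \<Rightarrow> real vec" where
  "rpart p q h = vec q (\<lambda>j. h $ (2*p + q + j))"

section \<open>Heisenberg representation, cocycle and twisted group algebra\<close>

definition heis ::
  "nat \<Rightarrow> nat \<Rightarrow> real vec \<Rightarrow> (real vec \<Rightarrow> int vec \<Rightarrow> complex) \<Rightarrow> (real vec \<Rightarrow> int vec \<Rightarrow> complex)" where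
  "heis p q h f = (\<lambda>s n.
     exp (2 * of_real pi * \<i> *
            of_real (w2 p h \<bullet> s + rpart p q h \<bullet> map_vec real_of_int n)
          + of_real pi * \<i> *
            of_real (w1 p h \<bullet> w2 p h + map_vec real_of_int (mpart p q h) \<bullet> rpart p q h))
     * f (s + w1 p h) (n + mpart p q h))"

definition cocyc :: "nat \<Rightarrow> nat \<Rightarrow> real vec \<Rightarrow> real vec \<Rightarrow> complex" where
  "cocyc p q g h = exp (of_real pi * \<i> * of_real
     (w1 p g \<bullet> w2 p h - w1 p h \<bullet> w2 p g
      + map_vec real_of_int (mpart p q g) \<bullet> rpart p q h
      - map_vec real_of_int (mpart p q h) \<bullet> rpart p q g))"

text \<open>
  A series \<open>\<Sum>h\<in>D. a\<^sub>h e(h)\<close> is its coefficient function, extended by 0 outside \<open>D\<close>. Decay is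
  measured on \<open>\<int>\<^sup>d\<close>, identified with \<open>D\<close> through \<open>\<Phi>\<close>.
\<close>

definition schwartz_alg :: "nat \<Rightarrow> nat \<Rightarrow> real mat \<Rightarrow> (real vec \<Rightarrow> complex) set" where
  "schwartz_alg p q \<Phi> = {a.
     (\<forall>h. h \<notin> lat p q \<Phi> \<longrightarrow> a h = 0) \<and>
     (\<forall>N::nat. \<exists>B::real. \<forall>x\<in>carrier_vec (2*p + q).
        (1 + (\<Sum>i<2*p + q. \<bar>real_of_int (x $ i)\<bar>)) ^ N * norm (a (emb \<Phi> x)) \<le> B)}"

definition delta :: "real vec \<Rightarrow> real vec \<Rightarrow> complex" where
  "delta h = (\<lambda>k. if k = h then 1 else 0)"

definition alg_scale :: "complex \<Rightarrow> (real vec \<Rightarrow> complex) \<Rightarrow> (real vec \<Rightarrow> complex)" where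
  "alg_scale c a = (\<lambda>k. c * a k)"

text \<open>The bilinear extension of \<open>e(g) e(h) = \<alpha>(g, h) e(g + h)\<close>, collecting the terms with \<open>g + h = k\<close>.\<close>

definition alg_mult ::
  "nat \<Rightarrow> nat \<Rightarrow> real mat \<Rightarrow> (real vec \<Rightarrow> complex) \<Rightarrow> (real vec \<Rightarrow> complex) \<Rightarrow> (real vec \<Rightarrow> complex)" where
  "alg_mult p q \<Phi> a b = (\<lambda>k. if k \<in> lat p q \<Phi>
     then (\<Sum>\<^sub>\<infinity>g\<in>lat p q \<Phi>. a g * b (k - g) * cocyc p q g (k - g)) else 0)"

text \<open>\<open>Pi\<^sub>M {..<p} (\<lambda>_. lborel)\<close> is Lebesgue measure on \<open>\<real>\<^sup>p\<close>, the unit point mass when \<open>p = 0\<close>.\<close>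

definition l2_inner ::
  "nat \<Rightarrow> nat \<Rightarrow> (real vec \<Rightarrow> int vec \<Rightarrow> complex) \<Rightarrow> (real vec \<Rightarrow> int vec \<Rightarrow> complex) \<Rightarrow> complex" where
  "l2_inner p q f1 f2 = (\<Sum>\<^sub>\<infinity>n\<in>carrier_vec q.
     (LINT s|Pi\<^sub>M {..<p} (\<lambda>_. lborel). f1 (vec p s) n * cnj (f2 (vec p s) n)))"

definition D_inner ::
  "nat \<Rightarrow> nat \<Rightarrow> real mat \<Rightarrow> (real vec \<Rightarrow> int vec \<Rightarrow> complex) \<Rightarrow> (real vec \<Rightarrow> int vec \<Rightarrow> complex)
    \<Rightarrow> (real vec \<Rightarrow> complex)" where
  "D_inner p q \<Phi> f1 f2 =
     (\<lambda>h. if h \<in> lat p q \<Phi> then l2_inner p q f1 (heis p q h f2) else 0)"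

section \<open>The quantum theta function\<close>

definition siegel :: "nat \<Rightarrow> complex mat \<Rightarrow> bool" where
  "siegel p \<Omega> \<longleftrightarrow> \<Omega> \<in> carrier_mat p p \<and> transpose_mat \<Omega> = \<Omega> \<and>
     (\<forall>v\<in>carrier_vec p. v \<noteq> 0\<^sub>v p \<longrightarrow> v \<bullet> (map_mat Im \<Omega> *\<^sub>v v) > 0)"

definition gauss :: "nat \<Rightarrow> nat \<Rightarrow> complex mat \<Rightarrow> real vec \<Rightarrow> int vec \<Rightarrow> complex" where
  "gauss p q \<Omega> s n = exp (of_real pi * \<i> *
       (\<Sum>j<p. \<Sum>k<p. of_real (s $ j) * \<Omega> $$ (j, k) * of_real (s $ k))
     - of_real (pi / 2 * (\<Sum>i<q div 2. (real_of_int (n $ i))\<^sup>2 + (real_of_int (n $ (q div 2 + i)))\<^sup>2)))"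

definition quantum_theta :: "nat \<Rightarrow> nat \<Rightarrow> real mat \<Rightarrow> complex mat \<Rightarrow> (real vec \<Rightarrow> complex)" where
  "quantum_theta p q \<Phi> \<Omega> = alg_scale (of_real (sqrt (2 ^ p * det (map_mat Im \<Omega>))))
     (D_inner p q \<Phi> (gauss p q \<Omega>) (gauss p q \<Omega>))"

definition classical_theta :: "complex \<Rightarrow> complex \<Rightarrow> complex" where
  "classical_theta \<tau> z = (\<Sum>\<^sub>\<infinity>n\<in>(UNIV :: int set).
     exp (of_real pi * \<i> * \<tau> * (of_int n)\<^sup>2 + 2 * of_real pi * \<i> * of_int n * z))"

definition w_under :: "nat \<Rightarrow> complex mat \<Rightarrow> real vec \<Rightarrow> complex vec" where
  "w_under p \<Omega> g = \<Omega> *\<^sub>v map_vec complex_of_real (w1 p g) + map_vec complex_of_real (w2 p g)"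

definition H_form :: "complex mat \<Rightarrow> complex vec \<Rightarrow> complex vec \<Rightarrow> complex" where
  "H_form \<Omega> v w =
     v \<bullet> (map_mat complex_of_real (the (mat_inverse (map_mat Im \<Omega>))) *\<^sub>v map_vec cnj w)"

definition b_tilde :: "nat \<Rightarrow> nat \<Rightarrow> real vec \<Rightarrow> complex" where
  "b_tilde p q g = (\<Prod>j<q.
     (let m = complex_of_int (mpart p q g $ j); r = complex_of_real (rpart p q g $ j)
      in exp (- (of_real pi / 2) * m\<^sup>2 - of_real pi * \<i> * m * r)
         * classical_theta \<i> (- r + \<i> * m / 2)))"

definition C_hat :: "nat \<Rightarrow> nat \<Rightarrow> complex mat \<Rightarrow> real vec \<Rightarrow> complex" where
  "C_hat p q \<Omega> g =
     b_tilde p q g * exp (- (of_real pi / 2) * H_form \<Omega> (w_under p \<Omega> g) (w_under p \<Omega> g))"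

text \<open>
  The quotient needs \<open>C_hat\<close> to be nonzero at \<open>g\<close> and \<open>h\<close>. This can fail: \<open>C_hat\<close> vanishes at \<open>g\<close>
  exactly when, for some \<open>j\<close>, the integer \<open>m\<^sub>j\<close> is odd and \<open>r\<^sub>j\<close> is congruent to \<open>1/2\<close> modulo 1,
  by the location of the zeros of \<open>\<theta>(\<i>, \<cdot>)\<close>.
\<close>

definition T_hat :: "nat \<Rightarrow> nat \<Rightarrow> complex mat \<Rightarrow> real vec \<Rightarrow> real vec \<Rightarrow> complex" where
  "T_hat p q \<Omega> g h =
     C_hat p q \<Omega> (g + h) / (C_hat p q \<Omega> g * C_hat p q \<Omega> h * cocyc p q g h)"

definition quantum_translation ::
  "nat \<Rightarrow> nat \<Rightarrow> complex mat \<Rightarrow> real vec \<Rightarrow> (real vec \<Rightarrow> complex) \<Rightarrow> (real vec \<Rightarrow> complex)" where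
  "quantum_translation p q \<Omega> g a = (\<lambda>h. T_hat p q \<Omega> g h * a h)"

end

theory Submission
  imports Defs "HOL-Probability.Characteristic_Functions"
begin

text \<open>
  The coefficient \<open>\<langle>f, \<pi>\<^sub>h f\<rangle>\<close> is \<open>c C\<^sub>h\<close> with \<open>c\<close> independent of \<open>h\<close>: its discrete part is literally a
  product of theta series, and its continuous part is a Gaussian integral whose exponent
  \<open>- \<pi>/2 cnj w Y\<inverse> cnj w - \<pi> \<i> w\<^sub>1 cnj w\<close>, with \<open>Y = Im \<Omega>\<close>, equals \<open>- \<pi>/2 w Y\<inverse> cnj w\<close> because
  \<open>w - cnj w = 2 \<i> Y w\<^sub>1\<close>. So the coefficients of \<open>\<Theta>\<close> are \<open>C\<^sub>h\<close> up to a common factor, and the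
  functional equation, being homogeneous in \<open>\<Theta>\<close>, reduces to the definition of \<open>T\<^sub>g\<close>.

  Rapid decay holds because \<open>C\<^sub>h\<close> is Gaussian in the first \<open>2p + q\<close> coordinates of \<open>h\<close>, and these
  control all of \<open>\<int>\<^sup>d\<close>: the remaining coordinates range over a compact group, so the square block of
  \<open>\<Phi>\<close> is invertible.
\<close>

unbundle no vec_syntax
unbundle no inner_syntax
hide_const (open) Finite_Cartesian_Product.vec Finite_Cartesian_Product.mat Determinants.det

section \<open>Gaussian integrals\<close>

text \<open>Completing the square in the real part of \<open>\<beta>\<close> alone and rescaling
  turns the integrand into the standard normal density times a character. The imaginary part then
  enters only through the characteristic function of the normal distribution, whose value is
  known.\<close>

lemma gaussian_integral:
  fixes a :: real and \<beta> :: complex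
  assumes a: "a > 0"
  shows "integrable lborel (\<lambda>t. exp (- of_real (a * t\<^sup>2) + \<beta> * of_real t))" (is ?I)
    and "(LINT t|lborel. exp (- of_real (a * t\<^sup>2) + \<beta> * of_real t))
           = of_real (sqrt (pi / a)) * exp (\<beta>\<^sup>2 / of_real (4 * a))" (is ?E)
proof -
  define x y where "x = Re \<beta>" and "y = Im \<beta>"
  have \<beta>: "\<beta> = of_real x + \<i> * of_real y" unfolding x_def y_def by (rule complex_eq)
  \<comment> \<open>This scale makes \<open>(s * t)\<^sup>2 / 2\<close> equal to
    \<open>a * t\<^sup>2\<close>, the exponent of the standard normal density.\<close>
  define s where "s = sqrt (2 * a)"
  have s: "s > 0" "s\<^sup>2 = 2 * a" using a by (auto simp: s_def)
  \<comment> \<open>\<open>C\<close> undoes three things: the normalisation of the density, the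
    constant from completing the square, and the phase picked up by the character at the shift
    \<open>x / s\<close>.\<close>
  define C :: complex where
    "C = of_real (sqrt (2 * pi)) * exp (of_real (x\<^sup>2 / (4 * a)) + \<i> * of_real (x * y / (2 * a)))"
  let ?g = "\<lambda>u. of_real (std_normal_density u) * iexp (y / s * u)"
  have g: "has_bochner_integral lborel ?g (of_real (exp (- (y / s)\<^sup>2 / 2)))"
  proof -
    have "char std_normal_distribution (y / s) = (LINT u|lborel. ?g u)"
      unfolding char_def by (subst integral_density) (auto simp: scaleR_conv_of_real)
    moreover have "integrable lborel ?g"
    proof (rule Bochner_Integration.integrable_bound[where f = std_normal_density])
      show "integrable lborel std_normal_density" by simp
    qed (auto simp: norm_mult)
    ultimately show ?thesis
      using char_std_normal_distribution by (simp add: has_bochner_integral_iff)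
  qed
  have eq: "exp (- of_real (a * t\<^sup>2) + \<beta> * of_real t) = C * ?g (- (x / s) + s * t)" for t
  proof -
    have sq: "(s * t - x / s)\<^sup>2 = 2 * a * t\<^sup>2 - 2 * x * t + x\<^sup>2 / (2 * a)"
      using s by (simp add: power2_diff power_mult_distrib power_divide)
    have 1: "of_real (std_normal_density (- (x / s) + s * t)) =
        of_real (1 / sqrt (2 * pi)) * exp (of_real (- (a * t\<^sup>2) + x * t - x\<^sup>2 / (4 * a)) :: complex)"
    proof -
      have "- (- (x / s) + s * t)\<^sup>2 / 2 = - (a * t\<^sup>2) + x * t - x\<^sup>2 / (4 * a)"
        using sq a by (simp add: field_simps)
      then show ?thesis
        unfolding std_normal_density_def of_real_mult exp_of_real by simp
    qed
    have yx: "y / s * (- (x / s) + s * t) = y * t - x * y / (2 * a)"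
    proof -
      have "y / s * (- (x / s) + s * t) = y * t - x * y / s\<^sup>2"
        using s(1) by (simp add: field_simps power2_eq_square)
      then show ?thesis using s(2) by simp
    qed
    have "sqrt (2 * pi) \<noteq> 0" by simp
    then have "C * ?g (- (x / s) + s * t) =
      exp (of_real (x\<^sup>2 / (4 * a)) + \<i> * of_real (x * y / (2 * a))) *
      (exp (of_real (- (a * t\<^sup>2) + x * t - x\<^sup>2 / (4 * a))) * exp (\<i> * of_real (y * t - x * y / (2 * a))))"
      unfolding 1 yx C_def by simp
    also have "\<dots> = exp (- of_real (a * t\<^sup>2) + \<beta> * of_real t)"
      unfolding exp_add[symmetric] \<beta> by (rule arg_cong[where f = exp]) (simp add: algebra_simps)
    finally show ?thesis by simp
  qed
  have "has_bochner_integral lborel (\<lambda>t. ?g (- (x / s) + s * t))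
      (of_real (exp (- (y / s)\<^sup>2 / 2)) /\<^sub>R \<bar>s\<bar>)"
    by (rule lborel_has_bochner_integral_real_affine_iff[THEN iffD1, OF _ g]) (use s in auto)
  then have "has_bochner_integral lborel (\<lambda>t. C * ?g (- (x / s) + s * t))
      (C * (of_real (exp (- (y / s)\<^sup>2 / 2)) /\<^sub>R \<bar>s\<bar>))"
    by (intro has_bochner_integral_mult_right) auto
  then have main: "has_bochner_integral lborel (\<lambda>t. exp (- of_real (a * t\<^sup>2) + \<beta> * of_real t))
      (C * (of_real (exp (- (y / s)\<^sup>2 / 2)) /\<^sub>R \<bar>s\<bar>))"
    unfolding eq .
  have "C * (of_real (exp (- (y / s)\<^sup>2 / 2)) /\<^sub>R \<bar>s\<bar>) =
      of_real (sqrt (2 * pi) / s) * (exp (of_real (x\<^sup>2 / (4 * a)) + \<i> * of_real (x * y / (2 * a)))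
         * exp (of_real (- (y / s)\<^sup>2 / 2)))"
    using s unfolding C_def exp_of_real[symmetric]
    by (simp add: scaleR_conv_of_real field_simps exp_of_real)
  also have "sqrt (2 * pi) / s = sqrt (pi / a)"
    using a by (simp add: s_def real_sqrt_divide[symmetric] real_sqrt_mult)
  also have "exp (of_real (x\<^sup>2 / (4 * a)) + \<i> * of_real (x * y / (2 * a)))
         * exp (of_real (- (y / s)\<^sup>2 / 2)) = exp (\<beta>\<^sup>2 / of_real (4 * a))"
    unfolding exp_add[symmetric] \<beta>
    using a s by (intro arg_cong[where f = exp])
      (simp add: field_simps power_divide power2_eq_square)
  finally show ?I ?E using main by (auto simp: has_bochner_integral_iff)
qed

section \<open>Quadratic forms and Schur complements\<close>

text \<open>The matrix is a function on indices and its size a separate argument, so that induction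
  on the dimension passes from \<open>Suc n\<close> to \<open>n\<close> without forming
  submatrices.\<close>

definition qform :: "nat \<Rightarrow> (nat \<Rightarrow> nat \<Rightarrow> real) \<Rightarrow> (nat \<Rightarrow> real) \<Rightarrow> real" where
  "qform n A v = (\<Sum>j<n. \<Sum>k<n. v j * A j k * v k)"

definition posdef :: "nat \<Rightarrow> (nat \<Rightarrow> nat \<Rightarrow> real) \<Rightarrow> bool" where
  "posdef n A \<longleftrightarrow> (\<forall>j<n. \<forall>k<n. A j k = A k j) \<and> (\<forall>v. (\<exists>j<n. v j \<noteq> 0) \<longrightarrow> qform n A v > 0)"

text \<open>The factor \<open>A k n\<close> stands where the usual Schur complement has
  \<open>A n k\<close>. With this choice the new form is exactly the form of \<open>A\<close> minus
  a square, and it agrees with the usual one for symmetric \<open>A\<close>.\<close>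

definition schur :: "nat \<Rightarrow> (nat \<Rightarrow> nat \<Rightarrow> real) \<Rightarrow> nat \<Rightarrow> nat \<Rightarrow> real" where
  "schur n A j k = A j k - A j n * A k n / A n n"

lemma qform_cong: "(\<And>j. j < n \<Longrightarrow> v j = w j) \<Longrightarrow> qform n A v = qform n A w"
  unfolding qform_def by (intro sum.cong) auto

lemma qform_Suc:
  assumes "\<forall>j<Suc n. \<forall>k<Suc n. A j k = A k j"
  shows "qform (Suc n) A v = qform n A v + 2 * (\<Sum>j<n. A j n * v j) * v n + A n n * (v n)\<^sup>2"
proof -
  have "(\<Sum>k<n. v n * A n k * v k) = v n * (\<Sum>j<n. A j n * v j)"
    unfolding sum_distrib_left using assms by (intro sum.cong) auto
  moreover have "(\<Sum>j<n. v j * A j n * v n) = v n * (\<Sum>j<n. A j n * v j)"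
    unfolding sum_distrib_left by (intro sum.cong) auto
  ultimately show ?thesis
    unfolding qform_def by (simp add: sum.distrib power2_eq_square algebra_simps)
qed

lemma qform_schur: "qform n (schur n A) v = qform n A v - (\<Sum>j<n. A j n * v j)\<^sup>2 / A n n"
  unfolding qform_def schur_def power2_eq_square sum_product sum_divide_distrib
    sum_subtractf[symmetric]
  by (intro sum.cong) (simp_all add: algebra_simps)

lemma posdef_pivot:
  assumes "posdef (Suc n) A"
  shows "A n n > 0"
proof -
  let ?e = "\<lambda>j. if j = n then 1 else 0 :: real"
  have "qform (Suc n) A ?e > 0" using assms unfolding posdef_def by fastforce
  moreover have "qform (Suc n) A ?e = A n n"
    by (subst qform_Suc) (use assms in \<open>auto simp: posdef_def qform_def\<close>)
  ultimately show ?thesis by simp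
qed

lemma qform_complete_square:
  assumes "posdef (Suc n) A"
  shows "qform (Suc n) A v =
    A n n * (v n + (\<Sum>j<n. A j n * v j) / A n n)\<^sup>2 + qform n (schur n A) v"
  using posdef_pivot[OF assms] assms
  by (simp add: qform_Suc posdef_def qform_schur power2_eq_square field_simps)

lemma posdef_schur:
  assumes A: "posdef (Suc n) A"
  shows "posdef n (schur n A)"
  unfolding posdef_def
proof (intro conjI allI impI)
  fix j k assume "j < n" "k < n"
  then show "schur n A j k = schur n A k j" using A by (auto simp: posdef_def schur_def)
next
  fix v :: "nat \<Rightarrow> real" assume "\<exists>j<n. v j \<noteq> 0"
  then obtain j where j: "j < n" "v j \<noteq> 0" by blast
  \<comment> \<open>This last coordinate makes the square in \<open>qform_complete_square\<close>
    vanish, so the Schur form at \<open>v\<close> is a value of the form of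
    \<open>A\<close>.\<close>
  define w where "w = v(n := - (\<Sum>j<n. A j n * v j) / A n n)"
  have wv: "j < n \<Longrightarrow> w j = v j" for j by (simp add: w_def)
  have "qform (Suc n) A w > 0" using A j wv unfolding posdef_def by (metis less_Suc_eq)
  also have "qform (Suc n) A w = qform n (schur n A) w"
    unfolding qform_complete_square[OF A] by (simp add: wv) (simp add: w_def)
  also have "\<dots> = qform n (schur n A) v" by (intro qform_cong wv)
  finally show "qform n (schur n A) v > 0" .
qed

text \<open>The constant is built by induction: the square completed in the last variable and the
  Schur form on the others together control every coordinate.\<close>

lemma posdef_coercive:
  assumes "posdef n A"
  shows "\<exists>c>0. \<forall>v. c * (\<Sum>j<n. (v j)\<^sup>2) \<le> qform n A v"
  using assms
proof (induction n arbitrary: A)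
  case 0
  then show ?case by (auto simp: qform_def intro: exI[of _ 1])
next
  case (Suc n)
  note pos = posdef_pivot[OF Suc.prems]
  obtain c where c: "c > 0" "\<And>v. c * (\<Sum>j<n. (v j)\<^sup>2) \<le> qform n (schur n A) v"
    using Suc.IH[OF posdef_schur[OF Suc.prems]] by blast
  \<comment> \<open>By Cauchy-Schwarz \<open>L\<close> bounds the square of the shift in the
    completed square. Since \<open>(v n)\<^sup>2\<close> is at most twice the completed square plus
    twice the squared shift, the other coordinates acquire weight \<open>1 + 2 * L\<close>, which
    explains the two bounds on \<open>d\<close>.\<close>
  define L where "L = (\<Sum>j<n. (A j n)\<^sup>2) / (A n n)\<^sup>2"
  have L: "L \<ge> 0" by (auto simp: L_def intro!: divide_nonneg_nonneg sum_nonneg)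
  define d where "d = min (A n n / 2) (c / (1 + 2 * L))"
  have d: "d > 0" "2 * d \<le> A n n"
    using pos c L by (auto simp: d_def)
  have dL: "d * (1 + 2 * L) \<le> c"
    using L by (subst pos_le_divide_eq[symmetric]) (auto simp: d_def)
  have "d * (\<Sum>j<Suc n. (v j)\<^sup>2) \<le> qform (Suc n) A v" for v
  proof -
    define W where "W = (\<Sum>j<n. (v j)\<^sup>2)"
    define l where "l = (\<Sum>j<n. A j n * v j) / A n n"
    have W: "W \<ge> 0" by (auto simp: W_def intro: sum_nonneg)
    have "l\<^sup>2 \<le> L * W"
      using Cauchy_Schwarz_ineq_sum[of "\<lambda>j. A j n" v "{..<n}"] pos
      by (simp add: l_def L_def W_def power_divide divide_right_mono)
    moreover have "(v n)\<^sup>2 \<le> 2 * (v n + l)\<^sup>2 + 2 * l\<^sup>2"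
      using zero_le_power2[of "v n + 2 * l"] by (simp add: power2_eq_square algebra_simps)
    ultimately have "d * (W + (v n)\<^sup>2) \<le> d * ((1 + 2 * L) * W + 2 * (v n + l)\<^sup>2)"
      using d by (intro mult_left_mono) (auto simp: algebra_simps)
    also have "\<dots> = (d * (1 + 2 * L)) * W + (2 * d) * (v n + l)\<^sup>2" by (simp add: algebra_simps)
    also have "\<dots> \<le> c * W + A n n * (v n + l)\<^sup>2"
      using d dL W by (intro add_mono mult_right_mono) auto
    also have "\<dots> \<le> qform (Suc n) A v"
      using c(2)[of v] unfolding qform_complete_square[OF Suc.prems] W_def l_def by simp
    finally show ?thesis by (simp add: W_def)
  qed
  with d show ?case by blast
qed

section \<open>Gaussian integrals in several variables\<close>

definition gauss_exp :: "nat \<Rightarrow> (nat \<Rightarrow> nat \<Rightarrow> real) \<Rightarrow> (nat \<Rightarrow> complex) \<Rightarrow> (nat \<Rightarrow> real) \<Rightarrow> complex" where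
  "gauss_exp n A b s = exp (- of_real (qform n A s) + (\<Sum>j<n. b j * of_real (s j)))"

text \<open>The linear coefficients that remain on the first \<open>n\<close> coordinates once the
  last one has been integrated out.\<close>

definition schur_lin :: "nat \<Rightarrow> (nat \<Rightarrow> nat \<Rightarrow> real) \<Rightarrow> (nat \<Rightarrow> complex) \<Rightarrow> nat \<Rightarrow> complex" where
  "schur_lin n A b j = b j - b n * of_real (A j n / A n n)"

lemma gauss_exp_measurable [measurable]:
  "gauss_exp n A b \<in> borel_measurable (Pi\<^sub>M {..<n} (\<lambda>_. lborel))"
proof -
  have [measurable]: "(\<lambda>s. s j) \<in> borel_measurable (Pi\<^sub>M {..<n} (\<lambda>_. lborel))" if "j < n" for j
    using measurable_component_singleton[of j "{..<n}" "\<lambda>_. lborel :: real measure"] that by simp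
  have [measurable]: "qform n A \<in> borel_measurable (Pi\<^sub>M {..<n} (\<lambda>_. lborel))"
    unfolding qform_def by (intro borel_measurable_sum borel_measurable_times) auto
  have [measurable]: "(\<lambda>s. \<Sum>j<n. b j * of_real (s j)) \<in> borel_measurable (Pi\<^sub>M {..<n} (\<lambda>_. lborel))"
    by (intro borel_measurable_sum borel_measurable_times borel_measurable_of_real) auto
  show ?thesis unfolding gauss_exp_def by measurable
qed

lemma gauss_exp_upd:
  assumes "posdef (Suc n) A"
  shows "gauss_exp (Suc n) A b (s(n := t)) = gauss_exp n A b s *
    exp (- of_real (A n n * t\<^sup>2) + (b n - 2 * of_real (\<Sum>j<n. A j n * s j)) * of_real t)"
proof -
  have "qform n A (s(n := t)) = qform n A s" by (rule qform_cong) simp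
  moreover have "(\<Sum>j<n. b j * of_real ((s(n := t)) j)) = (\<Sum>j<n. b j * of_real (s j))"
    "(\<Sum>j<n. A j n * (s(n := t)) j) = (\<Sum>j<n. A j n * s j)"
    by (intro sum.cong; simp)+
  ultimately show ?thesis
    using assms unfolding gauss_exp_def exp_add[symmetric]
    by (subst qform_Suc) (auto simp: posdef_def algebra_simps)
qed

text \<open>The second factor on the left is what integrating the last variable produces. In its
  expanded square, the quadratic term turns the form into the Schur form, the mixed term changes the
  linear coefficients, and the rest is a constant.\<close>

lemma gauss_exp_schur:
  assumes "posdef (Suc n) A"
  shows "gauss_exp n A b s *
      exp ((b n - 2 * of_real (\<Sum>j<n. A j n * s j))\<^sup>2 / of_real (4 * A n n)) =
    exp ((b n)\<^sup>2 / of_real (4 * A n n)) * gauss_exp n (schur n A) (schur_lin n A b) s"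
proof -
  have a: "A n n > 0" by (rule posdef_pivot[OF assms])
  define S where "S = (\<Sum>j<n. A j n * s j)"
  have lin: "(\<Sum>j<n. schur_lin n A b j * of_real (s j)) =
      (\<Sum>j<n. b j * of_real (s j)) - b n / of_real (A n n) * of_real S"
    unfolding S_def of_real_sum sum_distrib_left schur_lin_def sum_subtractf[symmetric]
    by (intro sum.cong) (simp_all add: algebra_simps)
  show ?thesis
    unfolding gauss_exp_def exp_add[symmetric] qform_schur S_def[symmetric] lin
    using a by (intro arg_cong[where f = exp]) (simp add: field_simps power2_eq_square)
qed

text \<open>For real \<open>\<beta>\<close> the integrand is its own norm, so the formula for the
  complex integral also gives the integral of the norm, in the form required by Tonelli.\<close>

lemma nn_integral_gaussian:
  assumes a: "a > 0" and \<beta>: "Im \<beta> = 0"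
  shows "(\<integral>\<^sup>+t. norm (exp (- of_real (a * t\<^sup>2) + \<beta> * of_real t)) \<partial>lborel) =
    ennreal (norm (of_real (sqrt (pi / a)) * exp (\<beta>\<^sup>2 / of_real (4 * a))))"
proof -
  let ?f = "\<lambda>t. exp (- of_real (a * t\<^sup>2) + \<beta> * of_real t)"
  have f: "?f t = of_real (norm (?f t))" for t
  proof -
    have "- of_real (a * t\<^sup>2) + \<beta> * of_real t = complex_of_real (- (a * t\<^sup>2) + Re \<beta> * t)"
      using \<beta> by (simp add: complex_eq_iff)
    then show ?thesis by (simp only: exp_of_real norm_of_real abs_exp_cancel)
  qed
  have i: "integrable lborel (\<lambda>t. norm (?f t))"
    by (intro integrable_norm gaussian_integral a)
  have "norm (LINT t|lborel. ?f t) = norm (LINT t|lborel. complex_of_real (norm (?f t)))"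
    using f by simp
  also have "\<dots> = (LINT t|lborel. norm (?f t))"
    unfolding integral_complex_of_real norm_of_real by (intro abs_of_nonneg integral_nonneg_AE) auto
  finally show ?thesis
    using nn_integral_eq_integral[OF i] gaussian_integral(2)[OF a, of \<beta>] by simp
qed

interpretation lborel_prod: product_sigma_finite "\<lambda>_ :: nat. lborel :: real measure"
  by (rule product_sigma_finite.intro) (rule lborel.sigma_finite_measure_axioms)

text \<open>Tonelli for the norm, one variable at a time; this supplies the integrability that
  Fubini demands in \<open>integral_gauss_exp\<close>.\<close>

lemma integrable_gauss_exp:
  assumes "posdef n A"
  shows "integrable (Pi\<^sub>M {..<n} (\<lambda>_. lborel)) (gauss_exp n A b)"
  using assms
proof (induction n arbitrary: A b)
  case 0
  then show ?case by (simp add: PiM_empty integrable_count_space)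
next
  case (Suc n)
  note a = posdef_pivot[OF Suc.prems]
  \<comment> \<open>The norm of \<open>gauss_exp\<close> depends only on the real parts of the
    linear coefficients, and with real coefficients \<open>nn_integral_gaussian\<close>
    applies.\<close>
  define b' where "b' j = complex_of_real (Re (b j))" for j
  let ?M = "\<lambda>n. Pi\<^sub>M {..<n} (\<lambda>_. lborel) :: (nat \<Rightarrow> real) measure"
  let ?g = "gauss_exp n (schur n A) (schur_lin n A b')"
  let ?c = "of_real (sqrt (pi / A n n)) * exp ((b' n)\<^sup>2 / of_real (4 * A n n))"
  have fin: "(\<integral>\<^sup>+s. norm (?c * ?g s) \<partial>?M n) < \<infinity>"
  proof -
    have "integrable (?M n) (\<lambda>s. ?c * ?g s)"
      by (intro integrable_mult_right Suc.IH posdef_schur Suc.prems)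
    then show ?thesis unfolding integrable_iff_bounded by (rule conjunct2)
  qed
  have inner: "(\<integral>\<^sup>+t. norm (gauss_exp (Suc n) A b' (s(n := t))) \<partial>lborel) = norm (?c * ?g s)" for s
  proof -
    let ?\<beta> = "b' n - 2 * of_real (\<Sum>j<n. A j n * s j)"
    have "Im ?\<beta> = 0" by (simp add: b'_def)
    then have "(\<integral>\<^sup>+t. norm (gauss_exp (Suc n) A b' (s(n := t))) \<partial>lborel) =
      ennreal (norm (gauss_exp n A b' s)) *
      ennreal (norm (of_real (sqrt (pi / A n n)) * exp (?\<beta>\<^sup>2 / of_real (4 * A n n))))"
      unfolding gauss_exp_upd[OF Suc.prems] norm_mult[of "gauss_exp n A b' s"]
      by (subst nn_integral_gaussian[OF a, symmetric]) (auto simp: ennreal_mult' nn_integral_cmult)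
    also have "\<dots> = norm (of_real (sqrt (pi / A n n)) *
       (gauss_exp n A b' s * exp (?\<beta>\<^sup>2 / of_real (4 * A n n))))"
      by (simp add: ennreal_mult'[symmetric] norm_mult mult_ac)
    finally show ?thesis unfolding gauss_exp_schur[OF Suc.prems] by (simp only: mult.assoc)
  qed
  have "(\<integral>\<^sup>+s. norm (gauss_exp (Suc n) A b' s) \<partial>?M (Suc n)) = (\<integral>\<^sup>+s. norm (?c * ?g s) \<partial>?M n)"
    unfolding lessThan_Suc
    by (subst lborel_prod.product_nn_integral_insert)
       (use gauss_exp_measurable[of "Suc n" A b'] in \<open>auto simp: inner lessThan_Suc\<close>)
  moreover have "norm (gauss_exp (Suc n) A b s) = norm (gauss_exp (Suc n) A b' s)" for s
    by (simp add: gauss_exp_def b'_def)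
  ultimately show ?case using fin by (intro integrableI_bounded) auto
qed

text \<open>
  \<open>u\<close> stands for \<open>A\<inverse> b / 2\<close>, so the exponent is \<open>b A\<inverse> b / 4\<close>. The constant
  \<open>\<pi>\<^sup>n\<^sup>/\<^sup>2 (det A)\<^sup>-\<^sup>1\<^sup>/\<^sup>2\<close> need not be identified.
\<close>

lemma integral_gauss_exp:
  assumes "posdef n A"
  shows "\<exists>c. \<forall>b u. (\<forall>j<n. (\<Sum>k<n. of_real (A j k) * u k) = b j / 2) \<longrightarrow>
    (LINT s|Pi\<^sub>M {..<n} (\<lambda>_. lborel). gauss_exp n A b s) = c * exp ((\<Sum>j<n. b j * u j) / 2)"
  using assms
proof (induction n arbitrary: A)
  case 0
  then show ?case
    by (auto simp: PiM_empty gauss_exp_def qform_def lebesgue_integral_count_space_finite intro: exI[of _ 1])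
next
  case (Suc n)
  note a = posdef_pivot[OF Suc.prems]
  let ?M = "\<lambda>n. Pi\<^sub>M {..<n} (\<lambda>_. lborel) :: (nat \<Rightarrow> real) measure"
  obtain c where c: "\<And>b u. (\<forall>j<n. (\<Sum>k<n. of_real (schur n A j k) * u k) = b j / 2) \<Longrightarrow>
    (LINT s|?M n. gauss_exp n (schur n A) b s) = c * exp ((\<Sum>j<n. b j * u j) / 2)"
    using Suc.IH[OF posdef_schur[OF Suc.prems]] by blast
  let ?r = "of_real (sqrt (pi / A n n))"
  have "(LINT s|?M (Suc n). gauss_exp (Suc n) A b s) = (?r * c) * exp ((\<Sum>j<Suc n. b j * u j) / 2)"
    if u: "\<forall>j<Suc n. (\<Sum>k<Suc n. of_real (A j k) * u k) = b j / 2" for b u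
  proof -
    define b' where "b' = schur_lin n A b"
    define U where "U = (\<Sum>k<n. complex_of_real (A k n) * u k)"
    have "(\<Sum>k<n. of_real (A n k) * u k) = U"
      unfolding U_def using Suc.prems by (intro sum.cong) (auto simp: posdef_def)
    with u have U: "U = b n / 2 - of_real (A n n) * u n"
      by (auto simp: algebra_simps)
    \<comment> \<open>Block elimination: substituting the last equation, in the form
      \<open>U\<close>, shows that the same \<open>u\<close>, cut to the first \<open>n\<close>
      indices, solves the system of the Schur complement.\<close>
    have u': "(\<Sum>k<n. of_real (schur n A j k) * u k) = b' j / 2" if j: "j < n" for j
    proof -
      have "(\<Sum>k<n. of_real (schur n A j k) * u k) =
          (\<Sum>k<n. of_real (A j k) * u k) - of_real (A j n / A n n) * U"
        unfolding U_def sum_distrib_left sum_subtractf[symmetric] schur_def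
        by (intro sum.cong) (simp_all add: algebra_simps)
      also have "(\<Sum>k<n. of_real (A j k) * u k) = b j / 2 - of_real (A j n) * u n"
        using u[rule_format, of j] j by (simp add: algebra_simps)
      finally show ?thesis using a by (simp add: U b'_def schur_lin_def field_simps)
    qed
    have bu: "(\<Sum>j<n. b' j * u j) = (\<Sum>j<Suc n. b j * u j) - (b n)\<^sup>2 / of_real (2 * A n n)"
    proof -
      have "(\<Sum>j<n. b' j * u j) = (\<Sum>j<n. b j * u j) - b n / of_real (A n n) * U"
        unfolding U_def sum_distrib_left sum_subtractf[symmetric] b'_def schur_lin_def
        by (intro sum.cong) (simp_all add: algebra_simps)
      then show ?thesis using a by (simp add: U field_simps power2_eq_square)
    qed
    have inner: "(LINT t|lborel. gauss_exp (Suc n) A b (s(n := t))) =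
        ?r * (exp ((b n)\<^sup>2 / of_real (4 * A n n)) * gauss_exp n (schur n A) b' s)" for s
      unfolding gauss_exp_upd[OF Suc.prems] integral_mult_right_zero gaussian_integral(2)[OF a]
        b'_def gauss_exp_schur[OF Suc.prems, symmetric] by (simp only: mult_ac)
    have "(LINT s|?M (Suc n). gauss_exp (Suc n) A b s) =
        (LINT s|?M n. LINT t|lborel. gauss_exp (Suc n) A b (s(n := t)))"
      using integrable_gauss_exp[OF Suc.prems, of b] unfolding lessThan_Suc
      by (intro lborel_prod.product_integral_insert) auto
    also have "\<dots> = ?r * (exp ((b n)\<^sup>2 / of_real (4 * A n n)) * (c * exp ((\<Sum>j<n. b' j * u j) / 2)))"
      unfolding inner integral_mult_right_zero using c[of u b'] u' by simp
    also have "\<dots> = (?r * c) * (exp ((b n)\<^sup>2 / of_real (4 * A n n)) * exp ((\<Sum>j<n. b' j * u j) / 2))"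
      by (simp only: mult_ac)
    also have "exp ((b n)\<^sup>2 / of_real (4 * A n n)) * exp ((\<Sum>j<n. b' j * u j) / 2) =
        exp ((\<Sum>j<Suc n. b j * u j) / 2)"
      unfolding exp_add[symmetric] bu using a
      by (intro arg_cong[where f = exp]) (simp add: field_simps)
    finally show ?thesis .
  qed
  then show ?case by blast
qed

section \<open>Lattices\<close>

lemma lattice_embedding_carrier:
  "lattice_embedding p q \<Phi> \<Longrightarrow> \<Phi> \<in> carrier_mat (2*p + 2*q) (2*p + q)"
  by (simp add: lattice_embedding_def)

lemma index_emb:
  assumes "\<Phi> \<in> carrier_mat N d" "x \<in> carrier_vec d" "i < N"
  shows "emb \<Phi> x $ i = (\<Sum>j<d. \<Phi> $$ (i, j) * real_of_int (x $ j))"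
  using assms by (auto simp: emb_def scalar_prod_def lessThan_atLeast0 intro!: sum.cong)

lemma emb_add:
  assumes "\<Phi> \<in> carrier_mat N d" "x \<in> carrier_vec d" "y \<in> carrier_vec d"
  shows "emb \<Phi> (x + y) = emb \<Phi> x + emb \<Phi> y"
proof -
  have "map_vec real_of_int (x + y) = map_vec real_of_int x + map_vec real_of_int y"
    using assms by (intro eq_vecI) auto
  then show ?thesis
    unfolding emb_def using assms by (simp add: mult_add_distrib_mat_vec)
qed

lemma emb_diff:
  assumes "\<Phi> \<in> carrier_mat N d" "x \<in> carrier_vec d" "y \<in> carrier_vec d"
  shows "emb \<Phi> (x - y) = emb \<Phi> x - emb \<Phi> y"
proof -
  have "map_vec real_of_int (x - y) = map_vec real_of_int x - map_vec real_of_int y"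
    using assms by (intro eq_vecI) auto
  then show ?thesis
    unfolding emb_def using assms by (simp add: mult_minus_distrib_mat_vec)
qed

lemma emb_dim: "\<Phi> \<in> carrier_mat N d \<Longrightarrow> emb \<Phi> x \<in> carrier_vec N"
  by (simp add: emb_def carrier_vecI)

lemma emb_Ints:
  assumes "lattice_embedding p q \<Phi>" "x \<in> carrier_vec (2*p + q)" "j < q"
  shows "emb \<Phi> x $ (2*p + j) \<in> \<int>"
  using assms unfolding lattice_embedding_def
  by (subst index_emb[of _ "2*p + 2*q" "2*p + q"]) (auto intro!: Ints_sum Ints_mult)

text \<open>The image of 0 is an open point of the discrete image. A product neighbourhood isolating
  it contains a box with one common radius, there being finitely many coordinates.\<close>

lemma lattice_discrete:
  assumes L: "lattice_embedding p q \<Phi>"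
  shows "\<exists>\<epsilon>>0. \<forall>z\<in>carrier_vec (2*p + q).
    (\<forall>i<2*p + 2*q. dist (phase_pt p q (emb \<Phi> z) i) (phase_pt p q (emb \<Phi> (0\<^sub>v (2*p + q))) i) < \<epsilon>)
    \<longrightarrow> z = 0\<^sub>v (2*p + q)"
proof -
  let ?N = "2*p + 2*q" and ?d = "2*p + q"
  define F where "F x = phase_pt p q (emb \<Phi> x)" for x
  define S where "S i = (if i < 2*p then \<real> else if i < 2*p + q then \<int> else sphere (0::complex) 1)" for i
  have ps: "phase_space p q = product_topology (\<lambda>i. top_of_set (S i)) {..<?N}"
    unfolding phase_space_def S_def ..
  let ?L = "F ` carrier_vec ?d"
  have inj: "inj_on F (carrier_vec ?d)" and disc: "subtopology (phase_space p q) ?L = discrete_topology ?L"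
    using L unfolding lattice_embedding_def F_def Let_def by auto
  \<comment> \<open>The discrete topology on \<open>?L\<close> has all of \<open>?L\<close> as its
    space, which forces \<open>?L\<close> to lie in the phase space.\<close>
  have LS: "?L \<subseteq> Pi\<^sub>E {..<?N} S"
    using arg_cong[OF disc, of topspace] by (simp add: ps) blast
  define e where "e = F (0\<^sub>v ?d)"
  have e: "e \<in> ?L" by (auto simp: e_def)
  then have "openin (subtopology (phase_space p q) ?L) {e}" by (simp add: disc)
  then obtain U where U: "openin (phase_space p q) U" "{e} = U \<inter> ?L"
    by (auto simp: openin_subtopology)
  then have "e \<in> U" by blast
  from bspec[OF U(1)[unfolded ps openin_product_topology_alt] this]
  obtain V where V: "\<forall>i\<in>{..<?N}. openin (top_of_set (S i)) (V i)" "e \<in> Pi\<^sub>E {..<?N} V"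
      "Pi\<^sub>E {..<?N} V \<subseteq> U"
    by (elim exE conjE)
  have "\<exists>\<epsilon>>0. ball (e i) \<epsilon> \<inter> S i \<subseteq> V i" if "i < ?N" for i
  proof -
    from that have "openin (top_of_set (S i)) (V i)" using V(1) by blast
    then obtain W where W: "open W" "V i = S i \<inter> W" unfolding openin_open by blast
    moreover have "e i \<in> W" using W V(2) that by (auto simp: PiE_iff)
    ultimately obtain r where "r > 0" "ball (e i) r \<subseteq> W" by (meson open_contains_ball)
    with W(2) show ?thesis by (intro exI[of _ r]) auto
  qed
  then obtain \<epsilon> where \<epsilon>: "\<And>i. i < ?N \<Longrightarrow> \<epsilon> i > 0" "\<And>i. i < ?N \<Longrightarrow> ball (e i) (\<epsilon> i) \<inter> S i \<subseteq> V i"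
    by metis
  \<comment> \<open>\<open>insert 1\<close> keeps the minimum defined when \<open>p\<close> and
    \<open>q\<close> are both 0.\<close>
  define \<delta> where "\<delta> = Min (insert 1 (\<epsilon> ` {..<?N}))"
  have \<delta>: "\<delta> > 0" "\<And>i. i < ?N \<Longrightarrow> \<delta> \<le> \<epsilon> i" using \<epsilon>(1) by (auto simp: \<delta>_def)
  have "z = 0\<^sub>v ?d" if z: "z \<in> carrier_vec ?d" and near: "\<forall>i<?N. dist (F z i) (e i) < \<delta>" for z
  proof -
    have FS: "F z \<in> Pi\<^sub>E {..<?N} S" using LS z by blast
    have "F z i \<in> V i" if "i < ?N" for i
    proof -
      have "F z i \<in> ball (e i) (\<epsilon> i)"
        using near \<delta>(2)[OF that] that by (auto simp: dist_commute)
      moreover have "F z i \<in> S i" using FS that by (auto simp: PiE_iff)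
      ultimately show ?thesis using \<epsilon>(2)[OF that] by blast
    qed
    with FS have "F z \<in> Pi\<^sub>E {..<?N} V" by (auto simp: PiE_iff)
    with V(3) U(2) z have "F z = e" by blast
    with inj z show ?thesis unfolding e_def by (auto dest: inj_onD)
  qed
  with \<delta>(1) show ?thesis unfolding F_def e_def by blast
qed

text \<open>
  If a real vector \<open>v\<close> were in the kernel, rounding its multiples \<open>k v\<close> would give infinitely many
  lattice points in a compact set; two of them would differ by a nonzero element close to 0.
\<close>

lemma lattice_block_nonsingular:
  assumes L: "lattice_embedding p q \<Phi>"
  shows "det (mat (2*p + q) (2*p + q) (\<lambda>ij. \<Phi> $$ ij)) \<noteq> 0" (is "det ?A \<noteq> 0")
proof
  let ?N = "2*p + 2*q" and ?d = "2*p + q"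
  note carr = lattice_embedding_carrier[OF L]
  assume "det ?A = 0"
  then obtain v0 where v0: "v0 \<in> carrier_vec ?d" "v0 \<noteq> 0\<^sub>v ?d" "?A *\<^sub>v v0 = 0\<^sub>v ?d"
    using det_0_iff_vec_prod_zero[of ?A ?d] by auto
  then obtain j0 where j0: "j0 < ?d" "v0 $ j0 \<noteq> 0" by (metis carrier_vecD eq_vecI index_zero_vec)
  \<comment> \<open>With entry 1 at \<open>j0\<close>, the rounded multiple \<open>x k\<close> has
    entry \<open>k\<close> there, so the \<open>x k\<close> are pairwise distinct.\<close>
  define v where "v j = v0 $ j / v0 $ j0" for j
  have v1: "v j0 = 1" using j0 by (simp add: v_def)
  have ker: "(\<Sum>j<?d. \<Phi> $$ (i, j) * v j) = 0" if "i < ?d" for i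
  proof -
    have "(?A *\<^sub>v v0) $ i = (\<Sum>j<?d. \<Phi> $$ (i, j) * v0 $ j)"
      using that v0(1) by (auto simp: scalar_prod_def lessThan_atLeast0 intro!: sum.cong)
    then show ?thesis using v0(3) that by (simp add: v_def sum_divide_distrib[symmetric])
  qed
  define x where "x k = vec ?d (\<lambda>j. \<lfloor>real k * v j\<rfloor>)" for k :: nat
  have x: "x k \<in> carrier_vec ?d" for k by (simp add: x_def)
  have xinj: "x k \<noteq> x l" if "k \<noteq> l" for k l
  proof
    assume "x k = x l"
    then have "x k $ j0 = x l $ j0" by simp
    with that j0(1) v1 show False by (simp add: x_def)
  qed
  \<comment> \<open>As \<open>v\<close> lies in the kernel of the square block, only the rounding
    errors, each at most 1, contribute to the first \<open>2*p + q\<close> coordinates of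
    \<open>emb \<Phi> (x k)\<close>. This gives a bound uniform in \<open>k\<close>.\<close>
  define C where "C = (\<Sum>i<?d. \<Sum>j<?d. \<bar>\<Phi> $$ (i, j)\<bar>)"
  have bd: "\<bar>emb \<Phi> (x k) $ i\<bar> \<le> C" if "i < ?d" for i k
  proof -
    have "emb \<Phi> (x k) $ i = (\<Sum>j<?d. \<Phi> $$ (i, j) * real_of_int (x k $ j))"
      using that by (intro index_emb[OF carr x]) auto
    also have "\<dots> = (\<Sum>j<?d. \<Phi> $$ (i, j) * (real_of_int (x k $ j) - real k * v j))"
      using ker[OF that] by (simp add: right_diff_distrib sum_subtractf mult.left_commute[of _ "real k"]
          sum_distrib_left[symmetric])
    also have "\<bar>\<dots>\<bar> \<le> (\<Sum>j<?d. \<bar>\<Phi> $$ (i, j)\<bar> * 1)"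
      unfolding abs_mult[symmetric]
    proof (rule order.trans[OF sum_abs], rule sum_mono)
      fix j assume "j \<in> {..<?d}"
      then have "\<bar>real_of_int (x k $ j) - real k * v j\<bar> \<le> 1"
        by (simp add: x_def) linarith
      then show "\<bar>\<Phi> $$ (i, j) * (real_of_int (x k $ j) - real k * v j)\<bar> \<le> \<bar>\<Phi> $$ (i, j)\<bar> * 1"
        unfolding abs_mult by (intro mult_left_mono) auto
    qed
    also have "\<dots> \<le> C"
      unfolding C_def using that by (auto intro!: member_le_sum sum_nonneg)
    finally show ?thesis .
  qed
  obtain \<epsilon> where \<epsilon>: "\<epsilon> > 0" and iso: "\<And>z. z \<in> carrier_vec ?d \<Longrightarrow>
    (\<forall>i<?N. dist (phase_pt p q (emb \<Phi> z) i) (phase_pt p q (emb \<Phi> (0\<^sub>v ?d)) i) < \<epsilon>) \<Longrightarrow> z = 0\<^sub>v ?d"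
    using lattice_discrete[OF L] by blast
  \<comment> \<open>Cells will have side \<open>\<epsilon> / 7\<close>: a difference
    \<open>t\<close> of fractional parts moves a point of the unit circle by at most
    \<open>2 * pi * \<bar>t\<bar>\<close>, and 7 exceeds \<open>2 * pi\<close>.\<close>
  define K where "K = 7 / \<epsilon>"
  have K: "K > 0" using \<epsilon> by (simp add: K_def)
  \<comment> \<open>\<open>F k\<close> names the cell containing the lattice point, the last
    \<open>q\<close> coordinates being read modulo 1. Since \<open>C + 1\<close> bounds the real
    coordinates as well as the fractional parts, finitely many cells occur and two distinct indices
    share one.\<close>
  define F where "F k = (\<lambda>i\<in>{..<?N}. if i < ?d then \<lfloor>K * emb \<Phi> (x k) $ i\<rfloor>
    else \<lfloor>K * frac (emb \<Phi> (x k) $ i)\<rfloor>)" for k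
  have "F k \<in> Pi\<^sub>E {..<?N} (\<lambda>_. {\<lfloor>- (K * (C + 1))\<rfloor>..\<lfloor>K * (C + 1)\<rfloor>})" for k
  proof (unfold PiE_iff, intro conjI ballI)
    fix i assume i: "i \<in> {..<?N}"
    have C: "C \<ge> 0" by (auto simp: C_def intro!: sum_nonneg)
    show "F k i \<in> {\<lfloor>- (K * (C + 1))\<rfloor>..\<lfloor>K * (C + 1)\<rfloor>}"
    proof (cases "i < ?d")
      case True
      have "\<bar>K * emb \<Phi> (x k) $ i\<bar> \<le> K * (C + 1)"
        unfolding abs_mult using K bd[OF True, of k] by (intro mult_mono) auto
      with True i show ?thesis by (auto simp: F_def intro!: floor_mono)
    next
      case False
      have "\<bar>K * frac (emb \<Phi> (x k) $ i)\<bar> \<le> K * (C + 1)"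
        unfolding abs_mult using K C frac_lt_1[of "emb \<Phi> (x k) $ i"] frac_ge_0[of "emb \<Phi> (x k) $ i"]
        by (intro mult_mono) auto
      with False i show ?thesis by (auto simp: F_def intro!: floor_mono)
    qed
  qed (auto simp: F_def)
  then have "finite (range F)"
    by (intro finite_subset[OF _ finite_PiE[of "{..<?N}" "\<lambda>_. {\<lfloor>- (K * (C + 1))\<rfloor>..\<lfloor>K * (C + 1)\<rfloor>}"]]) auto
  then have "\<not> inj F" using finite_imageD infinite_UNIV_nat by blast
  then obtain k l where kl: "k \<noteq> l" "F k = F l" by (auto simp: inj_def)
  define z where "z = x k - x l"
  have z: "z \<in> carrier_vec ?d" unfolding z_def using x by simp
  have ez: "emb \<Phi> z $ i = emb \<Phi> (x k) $ i - emb \<Phi> (x l) $ i" if "i < ?N" for i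
    unfolding z_def emb_diff[OF carr x x] using emb_dim[OF carr, of "x l"] that by simp
  have e0: "emb \<Phi> (0\<^sub>v ?d) $ i = 0" if "i < ?N" for i
    by (subst index_emb[OF carr _ that]) auto
  have close: "\<bar>a - b\<bar> < 1 / K" if "\<lfloor>K * a\<rfloor> = \<lfloor>K * b\<rfloor>" for a b
  proof -
    have "\<bar>K * a - K * b\<bar> < 1" using that by linarith
    moreover have "\<bar>K * a - K * b\<bar> = \<bar>a - b\<bar> * K"
      using K by (simp add: right_diff_distrib[symmetric] abs_mult)
    ultimately show ?thesis using K by (simp add: pos_less_divide_eq)
  qed
  have "dist (phase_pt p q (emb \<Phi> z) i) (phase_pt p q (emb \<Phi> (0\<^sub>v ?d)) i) < \<epsilon>" if i: "i < ?N" for i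
  proof (cases "i < ?d")
    case True
    with fun_cong[OF kl(2), of i] i have "\<bar>emb \<Phi> z $ i\<bar> < 1 / K"
      unfolding ez[OF i] by (intro close) (simp add: F_def)
    also have "\<dots> < \<epsilon>" using \<epsilon> by (simp add: K_def)
    finally show ?thesis using True i e0[OF i] by (simp add: phase_pt_def dist_norm)
  next
    case False
    define t where "t = frac (emb \<Phi> (x k) $ i) - frac (emb \<Phi> (x l) $ i)"
    define m where "m = \<lfloor>emb \<Phi> (x k) $ i\<rfloor> - \<lfloor>emb \<Phi> (x l) $ i\<rfloor>"
    have t: "\<bar>t\<bar> < 1 / K"
      unfolding t_def using fun_cong[OF kl(2), of i] i False by (intro close) (simp add: F_def)
    have "emb \<Phi> z $ i = t + of_int m" unfolding ez[OF i] t_def m_def frac_def by simp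
    then have "cis (2 * pi * emb \<Phi> z $ i) = cis (2 * pi * t + 2 * pi * of_int m)"
      by (simp add: distrib_left)
    also have "\<dots> = cis (2 * pi * t) * cis (2 * pi * of_int m)" by (simp only: cis_mult)
    also have "\<dots> = cis (2 * pi * t)" by simp
    finally have "dist (phase_pt p q (emb \<Phi> z) i) (phase_pt p q (emb \<Phi> (0\<^sub>v ?d)) i) =
        norm (cis (2 * pi * t) - 1)"
      using False i e0[OF i] by (simp add: phase_pt_def dist_norm)
    also have "\<dots> \<le> \<bar>2 * pi * t\<bar>" using iexp_approx1[of "2 * pi * t" 0] by (simp add: cis_conv_exp)
    also have "\<dots> \<le> 7 * \<bar>t\<bar>" using pi_less_4 pi_approx by (simp add: abs_mult mult_right_mono)
    also have "\<dots> < \<epsilon>" using t \<epsilon> by (simp add: K_def field_simps)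
    finally show ?thesis .
  qed
  then have "z = 0\<^sub>v ?d" using iso[OF z] by blast
  moreover have "x k = z + x l" unfolding z_def by (intro eq_vecI) (auto simp: x_def)
  ultimately show False using xinj[OF kl(1)] x[of l] by simp
qed

text \<open>The inverse of the square block recovers \<open>x\<close> from the first
  \<open>2*p + q\<close> coordinates of its image. This converts decay in those coordinates into the
  decay on \<open>\<int>\<^sup>d\<close> that \<open>schwartz_alg\<close> measures.\<close>

lemma lattice_norm_bound:
  assumes L: "lattice_embedding p q \<Phi>"
  shows "\<exists>M>0. \<forall>x\<in>carrier_vec (2*p + q).
    (\<Sum>j<2*p + q. \<bar>real_of_int (x $ j)\<bar>) \<le> M * (\<Sum>i<2*p + q. \<bar>emb \<Phi> x $ i\<bar>)"
proof -
  let ?N = "2*p + 2*q" and ?d = "2*p + q"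
  define A where "A = mat ?d ?d (\<lambda>ij. \<Phi> $$ ij)"
  have A: "A \<in> carrier_mat ?d ?d" by (simp add: A_def)
  have "A \<in> Units (ring_mat TYPE(real) ?d ())"
    using det_non_zero_imp_unit[OF A] lattice_block_nonsingular[OF L] by (simp add: A_def)
  then obtain B where B: "B \<in> carrier_mat ?d ?d" "B * A = 1\<^sub>m ?d"
    by (auto simp: Units_def ring_mat_def)
  \<comment> \<open>The summand 1 makes \<open>M\<close> positive even for an empty sum.\<close>
  define M where "M = (\<Sum>j<?d. \<Sum>i<?d. \<bar>B $$ (j, i)\<bar>) + 1"
  have "(\<Sum>j<?d. \<bar>real_of_int (x $ j)\<bar>) \<le> M * (\<Sum>i<?d. \<bar>emb \<Phi> x $ i\<bar>)"
    if x: "x \<in> carrier_vec ?d" for x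
  proof -
    let ?x = "map_vec real_of_int x"
    let ?S = "\<Sum>i<?d. \<bar>emb \<Phi> x $ i\<bar>"
    have S: "?S \<ge> 0" by (intro sum_nonneg) auto
    have Ax: "(A *\<^sub>v ?x) $ i = emb \<Phi> x $ i" if "i < ?d" for i
      using that x by (subst index_emb[OF lattice_embedding_carrier[OF L] x])
        (auto simp: A_def scalar_prod_def lessThan_atLeast0 intro!: sum.cong)
    have "\<bar>real_of_int (x $ j)\<bar> \<le> (\<Sum>i<?d. \<bar>B $$ (j, i)\<bar>) * ?S" if j: "j < ?d" for j
    proof -
      have "B *\<^sub>v (A *\<^sub>v ?x) = ?x"
        using A B x by (simp add: assoc_mult_mat_vec[symmetric, of _ ?d ?d _ ?d])
      then have "real_of_int (x $ j) = (B *\<^sub>v (A *\<^sub>v ?x)) $ j" using x j by simp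
      also have "\<dots> = (\<Sum>i<?d. B $$ (j, i) * emb \<Phi> x $ i)"
        using A B j by (auto simp: scalar_prod_def lessThan_atLeast0 Ax[symmetric] intro!: sum.cong)
      also have "\<bar>\<dots>\<bar> \<le> (\<Sum>i<?d. \<bar>B $$ (j, i)\<bar> * ?S)"
        by (rule order.trans[OF sum_abs], unfold abs_mult, intro sum_mono mult_left_mono member_le_sum) auto
      finally show ?thesis by (simp add: sum_distrib_right)
    qed
    then have "(\<Sum>j<?d. \<bar>real_of_int (x $ j)\<bar>) \<le> (\<Sum>j<?d. (\<Sum>i<?d. \<bar>B $$ (j, i)\<bar>) * ?S)"
      by (intro sum_mono) auto
    also have "\<dots> = (M - 1) * ?S" by (simp add: M_def sum_distrib_right)
    also have "\<dots> \<le> M * ?S" using S by (intro mult_right_mono) auto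
    finally show ?thesis .
  qed
  moreover have "M > 0" unfolding M_def by (intro add_nonneg_pos sum_nonneg) auto
  ultimately show ?thesis by blast
qed

section \<open>Theta series\<close>

lemma sum_lessThan_double: "(\<Sum>i<k. f i + f (k + i)) = (\<Sum>i<2 * k. f i)"
  for f :: "nat \<Rightarrow> 'a::comm_monoid_add"
proof -
  have "(\<Sum>i<k + m. f i) = (\<Sum>i<k. f i) + (\<Sum>i<m. f (k + i))" for m
    by (induction m) (auto simp: add.assoc)
  from this[of k] show ?thesis by (simp add: sum.distrib mult_2)
qed

lemma gaussian_summable_on_int:
  assumes c: "c > 0"
  shows "(\<lambda>n::int. exp (- c * (real_of_int n)\<^sup>2)) summable_on UNIV"
proof -
  let ?f = "\<lambda>n::int. exp (- c * (real_of_int n)\<^sup>2)"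
  have s: "(\<lambda>n::nat. exp (- c * (real n)\<^sup>2)) summable_on UNIV"
  proof (rule norm_summable_imp_summable_on, rule summable_comparison_test')
    show "summable (\<lambda>n. exp (- c) ^ n)" using c by (intro summable_geometric) simp
    fix n :: nat assume "n \<ge> 0"
    have "real n \<le> (real n)\<^sup>2" by (cases n) (auto simp: power2_eq_square)
    then show "norm (norm (exp (- c * (real n)\<^sup>2))) \<le> exp (- c) ^ n"
      using c by (simp add: exp_of_nat_mult[symmetric] mult.commute)
  qed
  have "?f summable_on range int" "?f summable_on range (\<lambda>n. - int n)"
    using s by (subst summable_on_reindex; simp add: inj_on_def o_def)+
  then have "?f summable_on (range int \<union> range (\<lambda>n. - int n))" by (rule summable_on_union)
  also have "range int \<union> range (\<lambda>n. - int n) = UNIV"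
  proof -
    have "x \<in> range int \<union> range (\<lambda>n. - int n)" for x by (cases x rule: int_cases2) auto
    then show ?thesis by blast
  qed
  finally show ?thesis .
qed

text \<open>What one discrete coordinate contributes to \<open>f\<close> times the conjugate of its
  Heisenberg translate: two Gaussians centred at 0 and \<open>-m\<close>, and the conjugated
  phases.\<close>

definition theta_term :: "int \<Rightarrow> real \<Rightarrow> int \<Rightarrow> complex" where
  "theta_term m r n = exp (- of_real (pi / 2 * ((real_of_int n)\<^sup>2 + (real_of_int (n + m))\<^sup>2))
     - of_real pi * \<i> * of_real (of_int m * r + 2 * (r * of_int n)))"

text \<open>Half of the exponent is kept for summability in \<open>n\<close>. The other half gives
  decay in \<open>m\<close>, by m^2 \<le> 2 (n^2 + (n + m)^2). The resulting bound is uniform in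
  \<open>r\<close>.\<close>

lemma norm_theta_term_le:
  "norm (theta_term m r n) \<le> exp (- (pi / 8) * (real_of_int m)\<^sup>2) * exp (- (pi / 4) * (real_of_int n)\<^sup>2)"
proof -
  define x y where "x = real_of_int n" and "y = real_of_int m"
  have "a / 4 + b / 8 \<le> (a + c) / 2" if "b \<le> 2 * (a + c)" "0 \<le> c" for a b c :: real
    using that by simp
  moreover have "y\<^sup>2 \<le> 2 * (x\<^sup>2 + (x + y)\<^sup>2)"
    using zero_le_power2[of "2 * x + y"] by (simp add: power2_eq_square algebra_simps)
  ultimately have *: "x\<^sup>2 / 4 + y\<^sup>2 / 8 \<le> (x\<^sup>2 + (x + y)\<^sup>2) / 2"
    using zero_le_power2 by blast
  have "norm (theta_term m r n) = exp (- pi * ((x\<^sup>2 + (x + y)\<^sup>2) / 2))"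
    by (simp add: theta_term_def x_def y_def)
  also have "\<dots> \<le> exp (- pi * (x\<^sup>2 / 4 + y\<^sup>2 / 8))"
    using mult_left_mono[OF *, of pi] by simp
  finally show ?thesis by (simp add: x_def y_def exp_add[symmetric] algebra_simps)
qed

lemma theta_term_abs_summable: "(\<lambda>n. norm (theta_term m r n)) summable_on UNIV"
  by (rule summable_on_comparison_test[OF _ norm_theta_term_le[of m r]])
     (intro summable_on_cmult_right gaussian_summable_on_int, auto)

lemma norm_infsum_theta_term_le:
  "norm (\<Sum>\<^sub>\<infinity>n. theta_term m r n) \<le>
    exp (- (pi / 8) * (real_of_int m)\<^sup>2) * (\<Sum>\<^sub>\<infinity>n::int. exp (- (pi / 4) * (real_of_int n)\<^sup>2))"
proof -
  have "norm (\<Sum>\<^sub>\<infinity>n. theta_term m r n) \<le> (\<Sum>\<^sub>\<infinity>n. norm (theta_term m r n))"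
    by (rule norm_infsum_bound[OF theta_term_abs_summable])
  also have "\<dots> \<le> (\<Sum>\<^sub>\<infinity>n. exp (- (pi / 8) * (real_of_int m)\<^sup>2) * exp (- (pi / 4) * (real_of_int n)\<^sup>2))"
    by (intro infsum_mono theta_term_abs_summable norm_theta_term_le
        summable_on_cmult_right gaussian_summable_on_int) auto
  finally show ?thesis unfolding infsum_cmult_right' .
qed

text \<open>The prefactor in \<open>b_tilde\<close> completes the square in the theta series: 2 n^2
  + 2 n m + m^2 = n^2 + (n + m)^2, the sum of the exponents of the two discrete Gaussians.\<close>

lemma b_tilde_eq:
  "b_tilde p q h = (\<Prod>j<q. \<Sum>\<^sub>\<infinity>n. theta_term (mpart p q h $ j) (rpart p q h $ j) n)"
proof -
  have "exp (- (of_real pi / 2) * (of_int m)\<^sup>2 - of_real pi * \<i> * of_int m * of_real r) *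
      classical_theta \<i> (- of_real r + \<i> * of_int m / 2) = (\<Sum>\<^sub>\<infinity>n. theta_term m r n)" for m r
    unfolding classical_theta_def infsum_cmult_right'[symmetric] exp_add[symmetric] theta_term_def
    by (intro infsum_cong arg_cong[where f = exp]) (simp add: algebra_simps power2_eq_square)
  then show ?thesis unfolding b_tilde_def Let_def by simp
qed

lemma infsum_prod_carrier_vec:
  fixes f :: "nat \<Rightarrow> 'b \<Rightarrow> 'c :: {banach, real_normed_div_algebra, comm_semiring_1}"
  assumes "\<And>j. j < q \<Longrightarrow> (\<lambda>n. norm (f j n)) summable_on UNIV"
  shows "(\<Sum>\<^sub>\<infinity>n\<in>carrier_vec q. \<Prod>j<q. f j (n $ j)) = (\<Prod>j<q. \<Sum>\<^sub>\<infinity>n. f j n)"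
proof -
  have "(\<Sum>\<^sub>\<infinity>n\<in>carrier_vec q. \<Prod>j<q. f j (n $ j)) = (\<Sum>\<^sub>\<infinity>g\<in>Pi\<^sub>E {..<q} (\<lambda>_. UNIV). \<Prod>j<q. f j (g j))"
    by (rule infsum_reindex_bij_witness[where j = "\<lambda>n. \<lambda>j\<in>{..<q}. n $ j" and i = "vec q"])
       (auto simp: PiE_iff extensional_def intro!: eq_vecI prod.cong)
  also have "\<dots> = (\<Prod>j<q. \<Sum>\<^sub>\<infinity>n. f j n)" using assms by (intro infsum_prod_PiE_abs) auto
  finally show ?thesis .
qed

section \<open>Coefficients of the quantum theta function\<close>

lemma siegel_carrier: "siegel p \<Omega> \<Longrightarrow> \<Omega> \<in> carrier_mat p p"
  by (simp add: siegel_def)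

lemma siegel_sym:
  assumes "siegel p \<Omega>" "j < p" "k < p"
  shows "\<Omega> $$ (j, k) = \<Omega> $$ (k, j)"
  using assms index_transpose_mat(1)[of k \<Omega> j] by (auto simp: siegel_def)

lemma siegel_posdef:
  assumes S: "siegel p \<Omega>"
  shows "posdef p (\<lambda>j k. Im (\<Omega> $$ (j, k)))"
  unfolding posdef_def
proof (intro conjI allI impI)
  fix j k assume "j < p" "k < p"
  then show "Im (\<Omega> $$ (j, k)) = Im (\<Omega> $$ (k, j))" using siegel_sym[OF S] by metis
next
  fix v :: "nat \<Rightarrow> real" assume "\<exists>j<p. v j \<noteq> 0"
  then obtain j where j: "j < p" "v j \<noteq> 0" by blast
  have "vec p v \<noteq> 0\<^sub>v p"
  proof
    assume "vec p v = 0\<^sub>v p"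
    then have "vec p v $ j = 0\<^sub>v p $ j" by simp
    with j show False by simp
  qed
  then have "vec p v \<bullet> (map_mat Im \<Omega> *\<^sub>v vec p v) > 0" using S by (auto simp: siegel_def)
  also have "vec p v \<bullet> (map_mat Im \<Omega> *\<^sub>v vec p v) = qform p (\<lambda>j k. Im (\<Omega> $$ (j, k))) v"
    unfolding qform_def using siegel_carrier[OF S]
    by (auto simp: scalar_prod_def lessThan_atLeast0 sum_distrib_left mult.assoc intro!: sum.cong)
  finally show "qform p (\<lambda>j k. Im (\<Omega> $$ (j, k))) v > 0" .
qed

lemma posdef_kernel:
  assumes "posdef n A" "\<And>j. j < n \<Longrightarrow> (\<Sum>k<n. A j k * v k) = 0" "j < n"
  shows "v j = 0"
proof -
  have "qform n A v = (\<Sum>j<n. v j * (\<Sum>k<n. A j k * v k))"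
    unfolding qform_def sum_distrib_left by (simp add: mult.assoc)
  also have "\<dots> = 0" using assms(2) by simp
  finally show ?thesis using assms(1,3) unfolding posdef_def by force
qed

lemma siegel_inverse:
  assumes S: "siegel p \<Omega>"
  obtains B where "mat_inverse (map_mat Im \<Omega>) = Some B" "B \<in> carrier_mat p p"
    "map_mat Im \<Omega> * B = 1\<^sub>m p"
proof -
  let ?Y = "map_mat Im \<Omega>"
  have Y: "?Y \<in> carrier_mat p p" using siegel_carrier[OF S] by simp
  have "det ?Y \<noteq> 0"
  proof
    assume "det ?Y = 0"
    then obtain v where v: "v \<in> carrier_vec p" "v \<noteq> 0\<^sub>v p" "?Y *\<^sub>v v = 0\<^sub>v p"
      using det_0_iff_vec_prod_zero[OF Y] by blast
    have "v \<bullet> (?Y *\<^sub>v v) > 0" using S v(1,2) by (simp add: siegel_def)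
    with v(1,3) show False by simp
  qed
  then have "?Y \<in> Units (ring_mat TYPE(real) p ())" by (rule det_non_zero_imp_unit[OF Y])
  then obtain B where "mat_inverse ?Y = Some B"
    using mat_inverse(1)[OF Y, where b = "()"] by (cases "mat_inverse ?Y") auto
  then show ?thesis using that mat_inverse(2)[OF Y] by blast
qed

lemma index_w_under:
  assumes "siegel p \<Omega>" "j < p"
  shows "w_under p \<Omega> h $ j = (\<Sum>k<p. \<Omega> $$ (j, k) * of_real (h $ k)) + of_real (h $ (p + j))"
  using siegel_carrier[OF assms(1)] assms(2)
  by (auto simp: w_under_def w1_def w2_def scalar_prod_def lessThan_atLeast0 intro!: sum.cong)

text \<open>Trades the inverse of \<open>Im \<Omega>\<close> for a solution \<open>z\<close> of a
  linear system, the shape in which both \<open>integral_gauss_exp\<close> and the coercivity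
  estimate work.\<close>

lemma siegel_dual:
  assumes S: "siegel p \<Omega>" and w: "w \<in> carrier_vec p"
  obtains z where "\<And>j. j < p \<Longrightarrow> (\<Sum>k<p. of_real (Im (\<Omega> $$ (j, k))) * z k) = cnj (w $ j)"
    "H_form \<Omega> w w = (\<Sum>j<p. w $ j * z j)"
proof -
  obtain B where B: "mat_inverse (map_mat Im \<Omega>) = Some B" "B \<in> carrier_mat p p"
    "map_mat Im \<Omega> * B = 1\<^sub>m p" using siegel_inverse[OF S] .
  define z where "z = map_mat complex_of_real B *\<^sub>v map_vec cnj w"
  let ?Y = "map_mat complex_of_real (map_mat Im \<Omega>)"
  have Y: "?Y \<in> carrier_mat p p" using siegel_carrier[OF S] by simp
  have cB: "map_mat complex_of_real B \<in> carrier_mat p p" using B by simp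
  have z: "z \<in> carrier_vec p" using B(2) by (simp add: z_def carrier_vecI)
  have "?Y * map_mat complex_of_real B = 1\<^sub>m p"
    using B(2,3) siegel_carrier[OF S]
    by (metis map_carrier_mat of_real_hom.mat_hom_mult of_real_hom.mat_hom_one)
  then have "?Y *\<^sub>v z = map_vec cnj w"
    unfolding z_def using Y cB w by (simp add: assoc_mult_mat_vec[symmetric])
  moreover have "(?Y *\<^sub>v z) $ j = (\<Sum>k<p. of_real (Im (\<Omega> $$ (j, k))) * z $ k)" if "j < p" for j
    using that z siegel_carrier[OF S]
    by (auto simp: scalar_prod_def lessThan_atLeast0 intro!: sum.cong)
  ultimately have "(\<Sum>k<p. of_real (Im (\<Omega> $$ (j, k))) * z $ k) = cnj (w $ j)" if "j < p" for j
    using that w by simp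
  moreover have "H_form \<Omega> w w = (\<Sum>j<p. w $ j * z $ j)"
    using z by (simp add: H_form_def B(1) z_def[symmetric] scalar_prod_def lessThan_atLeast0)
  ultimately show ?thesis by (rule that[of "\<lambda>j. z $ j"])
qed

lemma w_under_carrier: "siegel p \<Omega> \<Longrightarrow> w_under p \<Omega> h \<in> carrier_vec p"
  using siegel_carrier by (auto simp: w_under_def w2_def intro: carrier_vecI)

text \<open>Sort by degree in \<open>s\<close>. The quadratic terms combine through \<Omega> - cnj
  \<Omega> = 2 i Im \<Omega>. In degrees one and zero the phase supplies \<open>v\<close> and the
  conjugated translate supplies cnj \<Omega> applied to \<open>u\<close>, which add up to cnj
  w.\<close>

lemma heisenberg_gauss_exponent:
  fixes \<Omega> :: "nat \<Rightarrow> nat \<Rightarrow> complex" and u v s :: "nat \<Rightarrow> real"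
  assumes sym: "\<forall>j<p. \<forall>k<p. \<Omega> j k = \<Omega> k j"
    and w: "\<forall>j<p. w j = (\<Sum>k<p. \<Omega> j k * of_real (u k)) + of_real (v j)"
  shows "of_real pi * \<i> * (\<Sum>j<p. \<Sum>k<p. of_real (s j) * \<Omega> j k * of_real (s k))
    - 2 * of_real pi * \<i> * of_real (\<Sum>j<p. v j * s j) - of_real pi * \<i> * of_real (\<Sum>j<p. u j * v j)
    - of_real pi * \<i> * cnj (\<Sum>j<p. \<Sum>k<p. of_real (s j + u j) * \<Omega> j k * of_real (s k + u k))
    = - of_real (qform p (\<lambda>j k. 2 * pi * Im (\<Omega> j k)) s)
      + (\<Sum>j<p. (- 2 * of_real pi * \<i> * cnj (w j)) * of_real (s j))
      - of_real pi * \<i> * (\<Sum>j<p. of_real (u j) * cnj (w j))" (is "?l = ?r")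
proof -
  define Q where "Q a b = (\<Sum>j<p. \<Sum>k<p. of_real (a j) * cnj (\<Omega> j k) * of_real (b k))" for a b :: "nat \<Rightarrow> real"
  have Qsym: "Q u s = Q s u"
    unfolding Q_def by (subst sum.swap) (auto intro!: sum.cong simp: sym mult_ac)
  have exp: "cnj (\<Sum>j<p. \<Sum>k<p. of_real (s j + u j) * \<Omega> j k * of_real (s k + u k)) =
      Q s s + 2 * Q s u + Q u u"
  proof -
    have "cnj (\<Sum>j<p. \<Sum>k<p. of_real (s j + u j) * \<Omega> j k * of_real (s k + u k)) =
        Q s s + Q s u + Q u s + Q u u"
      unfolding Q_def cnj_sum sum.distrib[symmetric]
      by (intro sum.cong) (simp_all add: algebra_simps)
    then show ?thesis by (simp add: Qsym)
  qed
  have wQ: "(\<Sum>j<p. of_real (a j) * cnj (w j)) = Q a u + of_real (\<Sum>j<p. a j * v j)" for a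
    unfolding Q_def of_real_sum sum.distrib[symmetric]
    by (intro sum.cong) (simp_all add: w sum_distrib_left algebra_simps)
  have "(\<Sum>j<p. (- 2 * of_real pi * \<i> * cnj (w j)) * of_real (s j)) =
      - 2 * of_real pi * \<i> * (\<Sum>j<p. of_real (s j) * cnj (w j))"
    unfolding sum_distrib_left by (intro sum.cong) auto
  moreover have "of_real (qform p (\<lambda>j k. 2 * pi * Im (\<Omega> j k)) s) =
    - of_real pi * \<i> * ((\<Sum>j<p. \<Sum>k<p. of_real (s j) * \<Omega> j k * of_real (s k)) - Q s s)"
    unfolding Q_def qform_def sum_subtractf[symmetric] sum_distrib_left of_real_sum
    by (intro sum.cong) (auto simp: complex_eq_iff algebra_simps)
  moreover have "(\<Sum>j<p. v j * s j) = (\<Sum>j<p. s j * v j)" by (simp add: mult.commute)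
  ultimately show ?thesis unfolding exp wQ by (simp add: algebra_simps)
qed

text \<open>Separation of variables: after this the integral over \<open>s\<close> no longer depends
  on \<open>n\<close>, and the sum over \<open>n\<close> splits into one theta series per
  coordinate.\<close>

lemma gauss_times_cnj_heis:
  assumes q: "even q" and S: "siegel p \<Omega>" and n: "n \<in> carrier_vec q"
  shows "gauss p q \<Omega> (vec p s) n * cnj (heis p q h (gauss p q \<Omega>) (vec p s) n) =
    exp (- of_real pi * \<i> * (\<Sum>j<p. of_real (h $ j) * cnj (w_under p \<Omega> h $ j))) *
    gauss_exp p (\<lambda>j k. 2 * pi * Im (\<Omega> $$ (j, k))) (\<lambda>j. - 2 * of_real pi * \<i> * cnj (w_under p \<Omega> h $ j)) s *
    (\<Prod>j<q. theta_term (mpart p q h $ j) (rpart p q h $ j) (n $ j))"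
proof -
  define u v where "u j = h $ j" and "v j = h $ (p + j)" for j
  define m r where "m j = mpart p q h $ j" and "r j = rpart p q h $ j" for j
  \<comment> \<open>Evenness of \<open>q\<close> enters here: the pairs \<open>i\<close>,
    \<open>q div 2 + i\<close> in \<open>gauss\<close> then exhaust the discrete
    coordinates.\<close>
  have q2: "2 * (q div 2) = q" using q by simp
  have G: "gauss p q \<Omega> x k = exp (of_real pi * \<i> *
      (\<Sum>j<p. \<Sum>l<p. of_real (x $ j) * \<Omega> $$ (j, l) * of_real (x $ l))
      - of_real (pi / 2 * (\<Sum>i<q. (real_of_int (k $ i))\<^sup>2)))" for x k
    unfolding gauss_def sum_lessThan_double[of "\<lambda>i. (real_of_int (k $ i))\<^sup>2"] q2 ..
  have dots: "w2 p h \<bullet> vec p s = (\<Sum>j<p. v j * s j)" "w1 p h \<bullet> w2 p h = (\<Sum>j<p. u j * v j)"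
    "rpart p q h \<bullet> map_vec real_of_int n = (\<Sum>j<q. r j * real_of_int (n $ j))"
    "map_vec real_of_int (mpart p q h) \<bullet> rpart p q h = (\<Sum>j<q. real_of_int (m j) * r j)"
    using n by (auto simp: scalar_prod_def w1_def w2_def u_def v_def r_def m_def rpart_def mpart_def
        lessThan_atLeast0 intro!: sum.cong)
  have shift: "(\<Sum>j<p. \<Sum>l<p. of_real ((vec p s + w1 p h) $ j) * \<Omega> $$ (j, l) * of_real ((vec p s + w1 p h) $ l))
      = (\<Sum>j<p. \<Sum>l<p. of_real (s j + u j) * \<Omega> $$ (j, l) * of_real (s l + u l))"
    "(\<Sum>j<p. \<Sum>l<p. of_real (vec p s $ j) * \<Omega> $$ (j, l) * of_real (vec p s $ l))
      = (\<Sum>j<p. \<Sum>l<p. of_real (s j) * \<Omega> $$ (j, l) * of_real (s l))"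
    "(\<Sum>i<q. (real_of_int ((n + mpart p q h) $ i))\<^sup>2) = (\<Sum>i<q. (real_of_int (n $ i + m i))\<^sup>2)"
    using n by (auto simp: w1_def u_def m_def mpart_def intro!: sum.cong)
  have w: "\<forall>j<p. w_under p \<Omega> h $ j = (\<Sum>k<p. \<Omega> $$ (j, k) * of_real (u k)) + of_real (v j)"
    unfolding u_def v_def by (intro allI impI index_w_under[OF S])
  have sym: "\<forall>j<p. \<forall>k<p. \<Omega> $$ (j, k) = \<Omega> $$ (k, j)"
    by (intro allI impI siegel_sym[OF S])
  have disc: "(\<Prod>j<q. theta_term (m j) (r j) (n $ j)) =
    exp (- of_real (pi / 2 * (\<Sum>i<q. (real_of_int (n $ i))\<^sup>2))
      - of_real (pi / 2 * (\<Sum>i<q. (real_of_int (n $ i + m i))\<^sup>2))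
      - of_real pi * \<i> * of_real (\<Sum>j<q. real_of_int (m j) * r j)
      - 2 * of_real pi * \<i> * of_real (\<Sum>j<q. r j * real_of_int (n $ j)))"
    unfolding theta_term_def exp_sum[OF finite_lessThan, symmetric]
    by (intro arg_cong[where f = exp])
       (simp add: sum.distrib sum_subtractf sum_negf sum_distrib_left algebra_simps)
  have exp_shift: "exp (a - of_real pi * \<i> * x) = exp (- of_real pi * \<i> * x) * exp a" for a x :: complex
    unfolding exp_add[symmetric] by simp
  note exponent = heisenberg_gauss_exponent[of p "\<lambda>j k. \<Omega> $$ (j, k)" "\<lambda>j. w_under p \<Omega> h $ j" u v s,
      OF sym w]
  have "gauss p q \<Omega> (vec p s) n * cnj (heis p q h (gauss p q \<Omega>) (vec p s) n) =
    exp (of_real pi * \<i> * (\<Sum>j<p. \<Sum>k<p. of_real (s j) * \<Omega> $$ (j, k) * of_real (s k))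
      - 2 * of_real pi * \<i> * of_real (\<Sum>j<p. v j * s j) - of_real pi * \<i> * of_real (\<Sum>j<p. u j * v j)
      - of_real pi * \<i> * cnj (\<Sum>j<p. \<Sum>k<p. of_real (s j + u j) * \<Omega> $$ (j, k) * of_real (s k + u k)))
    * (\<Prod>j<q. theta_term (m j) (r j) (n $ j))"
    unfolding heis_def G dots shift disc complex_cnj_mult exp_cnj exp_add[symmetric]
    by (intro arg_cong[where f = exp]) (simp add: algebra_simps)
  also have "exp (of_real pi * \<i> * (\<Sum>j<p. \<Sum>k<p. of_real (s j) * \<Omega> $$ (j, k) * of_real (s k))
      - 2 * of_real pi * \<i> * of_real (\<Sum>j<p. v j * s j) - of_real pi * \<i> * of_real (\<Sum>j<p. u j * v j)
      - of_real pi * \<i> * cnj (\<Sum>j<p. \<Sum>k<p. of_real (s j + u j) * \<Omega> $$ (j, k) * of_real (s k + u k))) =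
    exp (- of_real pi * \<i> * (\<Sum>j<p. of_real (u j) * cnj (w_under p \<Omega> h $ j))) *
    gauss_exp p (\<lambda>j k. 2 * pi * Im (\<Omega> $$ (j, k))) (\<lambda>j. - 2 * of_real pi * \<i> * cnj (w_under p \<Omega> h $ j)) s"
    unfolding exponent gauss_exp_def by (rule exp_shift)
  finally show ?thesis unfolding m_def r_def u_def .
qed

lemma l2_inner_gauss_heis:
  assumes q: "even q" and S: "siegel p \<Omega>"
  shows "\<exists>c. \<forall>h. l2_inner p q (gauss p q \<Omega>) (heis p q h (gauss p q \<Omega>)) = c * C_hat p q \<Omega> h"
proof -
  let ?A = "\<lambda>j k. 2 * pi * Im (\<Omega> $$ (j, k))"
  note P = siegel_posdef[OF S]
  have "qform p ?A v = 2 * pi * qform p (\<lambda>j k. Im (\<Omega> $$ (j, k))) v" for v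
    unfolding qform_def sum_distrib_left by (intro sum.cong) auto
  with P have "posdef p ?A" by (simp add: posdef_def)
  from integral_gauss_exp[OF this] obtain c where c: "\<forall>b u.
    (\<forall>j<p. (\<Sum>k<p. of_real (?A j k) * u k) = b j / 2) \<longrightarrow>
    (LINT s|Pi\<^sub>M {..<p} (\<lambda>_. lborel). gauss_exp p ?A b s) = c * exp ((\<Sum>j<p. b j * u j) / 2)"
    by (elim exE)
  have main: "l2_inner p q (gauss p q \<Omega>) (heis p q h (gauss p q \<Omega>)) = c * C_hat p q \<Omega> h" for h
  proof -
    define w where "w j = w_under p \<Omega> h $ j" for j
    obtain z where z: "\<And>j. j < p \<Longrightarrow> (\<Sum>k<p. of_real (Im (\<Omega> $$ (j, k))) * z k) = cnj (w j)"
      and H: "H_form \<Omega> (w_under p \<Omega> h) (w_under p \<Omega> h) = (\<Sum>j<p. w j * z j)"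
      by (rule siegel_dual[OF S w_under_carrier[OF S, of h], folded w_def]) (rule that)
    let ?b = "\<lambda>j. - 2 * of_real pi * \<i> * cnj (w j)"
    \<comment> \<open>The form is \<open>2 * pi\<close> times \<open>Im \<Omega>\<close>, and
      \<open>z\<close> solves the system with right side \<open>cnj w\<close>, so this multiple of
      \<open>z\<close> solves the one with right side \<open>?b j / 2\<close>.\<close>
    let ?u = "\<lambda>j. - (\<i> / 2) * z j"
    let ?E = "exp (- of_real pi * \<i> * (\<Sum>j<p. of_real (h $ j) * cnj (w j)))"
    have "(\<Sum>k<p. of_real (?A j k) * ?u k) = ?b j / 2" if "j < p" for j
    proof -
      have "(\<Sum>k<p. of_real (?A j k) * ?u k) =
          - of_real pi * \<i> * (\<Sum>k<p. of_real (Im (\<Omega> $$ (j, k))) * z k)"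
        unfolding sum_distrib_left by (intro sum.cong) auto
      then show ?thesis unfolding z[OF that] by simp
    qed
    then have I: "(LINT s|Pi\<^sub>M {..<p} (\<lambda>_. lborel). gauss_exp p ?A ?b s) =
        c * exp ((\<Sum>j<p. ?b j * ?u j) / 2)"
      by (intro c[rule_format]) simp
    have Imw: "w j - cnj (w j) = 2 * \<i> * (\<Sum>k<p. of_real (Im (\<Omega> $$ (j, k))) * of_real (h $ k))"
      if "j < p" for j
    proof -
      have "w j - cnj (w j) = (\<Sum>k<p. (\<Omega> $$ (j, k) - cnj (\<Omega> $$ (j, k))) * of_real (h $ k))"
        unfolding w_def index_w_under[OF S that] by (simp add: sum_subtractf left_diff_distrib)
      then show ?thesis
        unfolding complex_diff_cnj sum_distrib_left by (simp add: mult_ac)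
    qed
    \<comment> \<open>By symmetry \<open>Im \<Omega>\<close> can be moved from the first coordinates
      of \<open>h\<close> onto \<open>z\<close>, where it yields \<open>cnj w\<close>. This is how
      the factor \<open>?E\<close> turns one \<open>cnj w\<close> of the Gaussian exponent into the
      \<open>w\<close> of \<open>H_form\<close>.\<close>
    have "(\<Sum>j<p. (w j - cnj (w j)) * z j) = 2 * \<i> * (\<Sum>k<p. of_real (h $ k) * cnj (w k))"
    proof -
      have "(\<Sum>j<p. (w j - cnj (w j)) * z j) =
          (\<Sum>j<p. \<Sum>k<p. 2 * \<i> * (of_real (h $ k) * (of_real (Im (\<Omega> $$ (k, j))) * z j)))"
        using siegel_sym[OF S] by (intro sum.cong) (auto simp: Imw sum_distrib_left sum_distrib_right mult_ac intro!: sum.cong)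
      also have "\<dots> = (\<Sum>k<p. 2 * \<i> * (of_real (h $ k) * (\<Sum>j<p. of_real (Im (\<Omega> $$ (k, j))) * z j)))"
        unfolding sum_distrib_left by (rule sum.swap)
      also have "\<dots> = 2 * \<i> * (\<Sum>k<p. of_real (h $ k) * cnj (w k))"
        by (subst sum_distrib_left, intro sum.cong) (auto simp: z)
      finally show ?thesis .
    qed
    then have wz: "(\<Sum>j<p. w j * z j) = (\<Sum>j<p. cnj (w j) * z j) + 2 * \<i> * (\<Sum>k<p. of_real (h $ k) * cnj (w k))"
      by (simp add: left_diff_distrib sum_subtractf algebra_simps)
    have "?b j * ?u j = - of_real pi * (cnj (w j) * z j)" for j
    proof -
      have "?b j * ?u j = (\<i> * \<i>) * of_real pi * (cnj (w j) * z j)" by (simp add: mult_ac)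
      then show ?thesis by simp
    qed
    then have bu: "(\<Sum>j<p. ?b j * ?u j) = - of_real pi * (\<Sum>j<p. cnj (w j) * z j)"
      by (simp only: sum_distrib_left)
    have EH: "?E * exp ((\<Sum>j<p. ?b j * ?u j) / 2) =
        exp (- (of_real pi / 2) * H_form \<Omega> (w_under p \<Omega> h) (w_under p \<Omega> h))"
    proof -
      have *: "- of_real pi * \<i> * x + - of_real pi * y / 2 = - (of_real pi / 2) * (y + 2 * \<i> * x)"
        for x y :: complex by (simp add: algebra_simps)
      show ?thesis unfolding exp_add[symmetric] H bu wz * ..
    qed
    let ?t = "\<lambda>n. \<Prod>j<q. theta_term (mpart p q h $ j) (rpart p q h $ j) (n $ j)"
    have "l2_inner p q (gauss p q \<Omega>) (heis p q h (gauss p q \<Omega>)) =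
       (\<Sum>\<^sub>\<infinity>n\<in>carrier_vec q. LINT s|Pi\<^sub>M {..<p} (\<lambda>_. lborel). ?E * gauss_exp p ?A ?b s * ?t n)"
      unfolding l2_inner_def using gauss_times_cnj_heis[OF q S] by (intro infsum_cong) (simp add: w_def)
    also have "\<dots> = ?E * (c * exp ((\<Sum>j<p. ?b j * ?u j) / 2)) * (\<Sum>\<^sub>\<infinity>n\<in>carrier_vec q. ?t n)"
      by (simp only: integral_mult_left_zero integral_mult_right_zero I infsum_cmult_right')
    also have "(\<Sum>\<^sub>\<infinity>n\<in>carrier_vec q. ?t n) = b_tilde p q h"
      unfolding b_tilde_eq by (rule infsum_prod_carrier_vec) (rule theta_term_abs_summable)
    also have "?E * (c * exp ((\<Sum>j<p. ?b j * ?u j) / 2)) = c * (?E * exp ((\<Sum>j<p. ?b j * ?u j) / 2))"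
      by (simp only: mult_ac)
    finally show ?thesis unfolding EH C_hat_def by (simp only: mult_ac)
  qed
  show ?thesis by (intro exI[of _ c] allI main)
qed

section \<open>Gaussian decay of the coefficients\<close>

text \<open>Write \<Omega> = X + i Y, w = \<Omega> u + v and z = x + i y with Y z = cnj w. Comparing
  real and imaginary parts gives y = -u and v = Y x - X u, while Re H is the sum of the values of
  \<open>Y\<close> at x and y. Coercivity of \<open>Y\<close> thus controls x and u, and through
  them v.\<close>

lemma H_form_coercive:
  assumes S: "siegel p \<Omega>"
  shows "\<exists>c>0. \<forall>h. c * (\<Sum>i<2*p. (h $ i)\<^sup>2) \<le> Re (H_form \<Omega> (w_under p \<Omega> h) (w_under p \<Omega> h))"
proof -
  define X Y where "X j k = Re (\<Omega> $$ (j, k))" and "Y j k = Im (\<Omega> $$ (j, k))" for j k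
  have P: "posdef p Y" using siegel_posdef[OF S] by (simp add: Y_def[abs_def])
  obtain c where c: "c > 0" "\<And>v. c * (\<Sum>j<p. (v j)\<^sup>2) \<le> qform p Y v"
    using posdef_coercive[OF P] by blast
  \<comment> \<open>Cauchy-Schwarz applied to v = Y x - X u bounds the squared length of v by
    \<open>2 * N\<close> times that of x and u together; adding u itself gives the weight
    \<open>1 + 2 * N\<close>.\<close>
  define N where "N = (\<Sum>j<p. \<Sum>k<p. (Y j k)\<^sup>2 + (X j k)\<^sup>2)"
  have N: "N \<ge> 0" by (auto simp: N_def intro!: sum_nonneg)
  have "c / (1 + 2 * N) * (\<Sum>i<2*p. (h $ i)\<^sup>2) \<le> Re (H_form \<Omega> (w_under p \<Omega> h) (w_under p \<Omega> h))" for h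
  proof -
    define w where "w j = w_under p \<Omega> h $ j" for j
    obtain z where z: "\<And>j. j < p \<Longrightarrow> (\<Sum>k<p. of_real (Im (\<Omega> $$ (j, k))) * z k) = cnj (w j)"
      and H: "H_form \<Omega> (w_under p \<Omega> h) (w_under p \<Omega> h) = (\<Sum>j<p. w j * z j)"
      by (rule siegel_dual[OF S w_under_carrier[OF S, of h], folded w_def]) (rule that)
    define x y where "x j = Re (z j)" and "y j = Im (z j)" for j
    define u v where "u j = h $ j" and "v j = h $ (p + j)" for j
    have Rew: "Re (w j) = (\<Sum>k<p. Y j k * x k)" and Imw: "Im (w j) = - (\<Sum>k<p. Y j k * y k)" if "j < p" for j
      using arg_cong[OF z[OF that], of Re] arg_cong[OF z[OF that], of Im]
      by (simp_all add: x_def y_def Y_def)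
    have Rew': "Re (w j) = (\<Sum>k<p. X j k * u k) + v j" and Imw': "Im (w j) = (\<Sum>k<p. Y j k * u k)"
      if "j < p" for j
      unfolding w_def index_w_under[OF S that] by (simp_all add: X_def Y_def u_def v_def)
    have yu: "y j = - u j" if "j < p" for j
    proof -
      have "(\<Sum>k<p. Y i k * (y k + u k)) = 0" if "i < p" for i
        using Imw[OF that] Imw'[OF that] by (simp add: distrib_left sum.distrib)
      from posdef_kernel[OF P this that] show ?thesis by simp
    qed
    define Sx Su where "Sx = (\<Sum>k<p. (x k)\<^sup>2)" and "Su = (\<Sum>k<p. (u k)\<^sup>2)"
    have nn: "Sx \<ge> 0" "Su \<ge> 0" by (auto simp: Sx_def Su_def intro!: sum_nonneg)
    have "Re (\<Sum>j<p. w j * z j) = (\<Sum>j<p. x j * Re (w j) - y j * Im (w j))"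
      by (simp add: x_def y_def mult.commute)
    also have "\<dots> = qform p Y x + qform p Y y"
      unfolding qform_def sum.distrib[symmetric]
      by (intro sum.cong) (simp_all add: Rew Imw sum_distrib_left sum.distrib mult.assoc)
    finally have "Re (\<Sum>j<p. w j * z j) = qform p Y x + qform p Y y" .
    moreover have "c * Su \<le> qform p Y y" using c(2)[of y] by (simp add: Su_def yu)
    ultimately have ReH: "c * (Sx + Su) \<le> Re (\<Sum>j<p. w j * z j)"
      using c(2)[of x] by (simp add: Sx_def distrib_left)
    have "(v j)\<^sup>2 \<le> (\<Sum>k<p. (Y j k)\<^sup>2 + (X j k)\<^sup>2) * (2 * (Sx + Su))" if j: "j < p" for j
    proof -
      define a b where "a = (\<Sum>k<p. Y j k * x k)" and "b = (\<Sum>k<p. X j k * u k)"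
      have v: "v j = a - b" using Rew[OF j] Rew'[OF j] by (simp add: a_def b_def)
      have "(v j)\<^sup>2 \<le> 2 * a\<^sup>2 + 2 * b\<^sup>2"
        unfolding v using zero_le_power2[of "a + b"] by (simp add: power2_eq_square algebra_simps)
      also have "a\<^sup>2 \<le> (\<Sum>k<p. (Y j k)\<^sup>2) * Sx" unfolding a_def Sx_def by (rule Cauchy_Schwarz_ineq_sum)
      also have "b\<^sup>2 \<le> (\<Sum>k<p. (X j k)\<^sup>2) * Su" unfolding b_def Su_def by (rule Cauchy_Schwarz_ineq_sum)
      finally have "(v j)\<^sup>2 \<le> 2 * ((\<Sum>k<p. (Y j k)\<^sup>2) * Sx) + 2 * ((\<Sum>k<p. (X j k)\<^sup>2) * Su)" by simp
      moreover have "(\<Sum>k<p. (Y j k)\<^sup>2) * Su \<ge> 0" "(\<Sum>k<p. (X j k)\<^sup>2) * Sx \<ge> 0"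
        using nn by (auto intro!: mult_nonneg_nonneg sum_nonneg)
      ultimately show ?thesis by (simp add: sum.distrib algebra_simps)
    qed
    then have "(\<Sum>j<p. (v j)\<^sup>2) \<le> N * (2 * (Sx + Su))"
      unfolding N_def sum_distrib_right[of _ "{..<p}" "2 * (Sx + Su)"] by (intro sum_mono) auto
    moreover have "(\<Sum>i<2*p. (h $ i)\<^sup>2) = Su + (\<Sum>j<p. (v j)\<^sup>2)"
      unfolding sum_lessThan_double[symmetric] sum.distrib by (simp add: Su_def u_def v_def)
    ultimately have "(\<Sum>i<2*p. (h $ i)\<^sup>2) \<le> (1 + 2 * N) * (Sx + Su)"
      using nn by (simp add: algebra_simps)
    then have "c / (1 + 2 * N) * (\<Sum>i<2*p. (h $ i)\<^sup>2) \<le> c / (1 + 2 * N) * ((1 + 2 * N) * (Sx + Su))"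
      using c(1) N by (intro mult_left_mono) auto
    also have "\<dots> = c * (Sx + Su)" using N by simp
    finally show ?thesis using ReH H by simp
  qed
  moreover have "c / (1 + 2 * N) > 0" using c(1) N by simp
  ultimately show ?thesis by blast
qed

text \<open>Decay in the first \<open>2*p\<close> coordinates comes from \<open>H_form\<close>, in
  the next \<open>q\<close> from the theta series. Integrality ensures that the floor in
  \<open>mpart\<close> returns the coordinate itself.\<close>

lemma norm_C_hat_le:
  assumes S: "siegel p \<Omega>"
  shows "\<exists>K\<ge>0. \<exists>c>0. \<forall>h. (\<forall>j<q. h $ (2*p + j) \<in> \<int>) \<longrightarrow>
    norm (C_hat p q \<Omega> h) \<le> K * exp (- c * (\<Sum>i<2*p + q. (h $ i)\<^sup>2))"
proof -
  obtain c0 where c0: "c0 > 0" "\<And>h. c0 * (\<Sum>i<2*p. (h $ i)\<^sup>2) \<le>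
      Re (H_form \<Omega> (w_under p \<Omega> h) (w_under p \<Omega> h))"
    using H_form_coercive[OF S] by blast
  define s where "s = (\<Sum>\<^sub>\<infinity>n::int. exp (- (pi / 4) * (real_of_int n)\<^sup>2))"
  have s: "s \<ge> 0" unfolding s_def by (intro infsum_nonneg) auto
  define c where "c = min (pi / 2 * c0) (pi / 8)"
  have c: "c > 0" "c \<le> pi / 2 * c0" "c \<le> pi / 8" using c0 by (auto simp: c_def)
  have "norm (C_hat p q \<Omega> h) \<le> s ^ q * exp (- c * (\<Sum>i<2*p + q. (h $ i)\<^sup>2))"
    if h: "\<forall>j<q. h $ (2*p + j) \<in> \<int>" for h
  proof -
    define A B where "A = (\<Sum>i<2*p. (h $ i)\<^sup>2)" and "B = (\<Sum>j<q. (h $ (2*p + j))\<^sup>2)"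
    have nn: "A \<ge> 0" "B \<ge> 0" by (auto simp: A_def B_def intro!: sum_nonneg)
    have AB: "(\<Sum>i<2*p + q. (h $ i)\<^sup>2) = A + B"
      unfolding A_def B_def by (induction q) (auto simp: add.assoc)
    have m: "real_of_int (mpart p q h $ j) = h $ (2*p + j)" if "j < q" for j
      using h that by (auto simp: mpart_def elim!: Ints_cases)
    have "norm (\<Sum>\<^sub>\<infinity>n. theta_term (mpart p q h $ j) (rpart p q h $ j) n) \<le>
        exp (- (pi / 8) * (h $ (2*p + j))\<^sup>2) * s" if "j < q" for j
      using norm_infsum_theta_term_le[of "mpart p q h $ j" "rpart p q h $ j"] m[OF that]
      by (simp add: s_def)
    then have "norm (b_tilde p q h) \<le> (\<Prod>j<q. exp (- (pi / 8) * (h $ (2*p + j))\<^sup>2) * s)"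
      unfolding b_tilde_eq prod_norm[symmetric]
      by (intro prod_mono) auto
    also have "\<dots> = s ^ q * exp (- (pi / 8) * B)"
      by (simp add: prod.distrib exp_sum[symmetric] sum_distrib_left B_def)
    finally have b: "norm (b_tilde p q h) \<le> s ^ q * exp (- (pi / 8) * B)" .
    have "norm (exp (- (of_real pi / 2) * H_form \<Omega> (w_under p \<Omega> h) (w_under p \<Omega> h))) \<le> exp (- (pi / 2 * c0) * A)"
      using c0(2)[of h] by (simp add: A_def)
    with b have "norm (C_hat p q \<Omega> h) \<le> (s ^ q * exp (- (pi / 8) * B)) * exp (- (pi / 2 * c0) * A)"
      unfolding C_hat_def norm_mult using s by (intro mult_mono) auto
    also have "\<dots> = s ^ q * exp (- (pi / 8) * B - (pi / 2 * c0) * A)"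
      by (simp add: exp_add[symmetric])
    also have "\<dots> \<le> s ^ q * exp (- c * (A + B))"
      using mult_right_mono[OF c(2) nn(1)] mult_right_mono[OF c(3) nn(2)] s
      by (intro mult_left_mono) (auto simp: algebra_simps)
    finally show ?thesis unfolding AB .
  qed
  moreover have "s ^ q \<ge> 0" using s by simp
  ultimately show ?thesis using c(1) by blast
qed

definition l1_norm :: "int vec \<Rightarrow> real" where
  "l1_norm x = (\<Sum>j<dim_vec x. \<bar>real_of_int (x $ j)\<bar>)"

lemma l1_norm_nonneg [simp]: "l1_norm x \<ge> 0"
  by (simp add: l1_norm_def sum_nonneg)

lemma norm_C_hat_emb_le:
  assumes S: "siegel p \<Omega>" and L: "lattice_embedding p q \<Phi>"
  shows "\<exists>K\<ge>0. \<exists>c>0. \<forall>x\<in>carrier_vec (2*p + q).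
    norm (C_hat p q \<Omega> (emb \<Phi> x)) \<le> K * exp (- c * (l1_norm x)\<^sup>2)"
proof -
  let ?d = "2*p + q"
  obtain K c where Kc: "K \<ge> 0" "c > 0" and C: "\<And>h. (\<forall>j<q. h $ (2*p + j) \<in> \<int>) \<Longrightarrow>
      norm (C_hat p q \<Omega> h) \<le> K * exp (- c * (\<Sum>i<?d. (h $ i)\<^sup>2))"
    using norm_C_hat_le[OF S, of q] by blast
  obtain M where M: "M > 0" "\<And>x. x \<in> carrier_vec ?d \<Longrightarrow>
      (\<Sum>j<?d. \<bar>real_of_int (x $ j)\<bar>) \<le> M * (\<Sum>i<?d. \<bar>emb \<Phi> x $ i\<bar>)"
    using lattice_norm_bound[OF L] by blast
  \<comment> \<open>\<open>M\<^sup>2\<close> comes from \<open>lattice_norm_bound\<close>, the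
    dimension from comparing the l1 and l2 norms, and the added 1 keeps \<open>R\<close> positive in
    dimension 0.\<close>
  define R where "R = M\<^sup>2 * real (?d + 1)"
  have R: "R > 0" using M by (auto simp: R_def)
  have "norm (C_hat p q \<Omega> (emb \<Phi> x)) \<le> K * exp (- (c / R) * (l1_norm x)\<^sup>2)"
    if x: "x \<in> carrier_vec ?d" for x
  proof -
    let ?Q = "\<Sum>i<?d. (emb \<Phi> x $ i)\<^sup>2"
    have Q: "?Q \<ge> 0" by (intro sum_nonneg) auto
    have "(l1_norm x)\<^sup>2 \<le> (M * (\<Sum>i<?d. \<bar>emb \<Phi> x $ i\<bar>))\<^sup>2"
      using M(2)[OF x] x by (intro power_mono) (auto simp: l1_norm_def sum_nonneg)
    also have "\<dots> \<le> M\<^sup>2 * (?Q * real ?d)"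
      using sum_squared_le_sum_of_squares[of "\<lambda>i. \<bar>emb \<Phi> x $ i\<bar>" "{..<?d}"]
      unfolding power_mult_distrib by (intro mult_left_mono) auto
    also have "\<dots> \<le> R * ?Q"
      using Q unfolding R_def mult.assoc by (intro mult_left_mono) (auto simp: algebra_simps)
    finally have "c / R * (l1_norm x)\<^sup>2 \<le> c / R * (R * ?Q)"
      using Kc R by (intro mult_left_mono) auto
    then have "c / R * (l1_norm x)\<^sup>2 \<le> c * ?Q" using R by simp
    then have "K * exp (- c * ?Q) \<le> K * exp (- (c / R) * (l1_norm x)\<^sup>2)"
      using Kc by (intro mult_left_mono) auto
    with C[of "emb \<Phi> x"] emb_Ints[OF L x] show ?thesis by simp
  qed
  moreover have "c / R > 0" using Kc R by simp
  ultimately show ?thesis using Kc(1) by blast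
qed

text \<open>The polynomial weight is at most exp(N t), and completing the square bounds N t - c t^2
  by N^2 / (4 c).\<close>

lemma schwartz_algI_gaussian:
  assumes c: "c > 0" and out: "\<And>h. h \<notin> lat p q \<Phi> \<Longrightarrow> a h = 0"
    and bound: "\<And>x. x \<in> carrier_vec (2*p + q) \<Longrightarrow> norm (a (emb \<Phi> x)) \<le> K * exp (- c * (l1_norm x)\<^sup>2)"
  shows "a \<in> schwartz_alg p q \<Phi>"
proof -
  have "(1 + (\<Sum>i<2*p + q. \<bar>real_of_int (x $ i)\<bar>)) ^ N * norm (a (emb \<Phi> x)) \<le> \<bar>K\<bar> * exp ((real N)\<^sup>2 / (4 * c))"
    if x: "x \<in> carrier_vec (2*p + q)" for x N
  proof -
    define t where "t = l1_norm x"
    have t: "(\<Sum>i<2*p + q. \<bar>real_of_int (x $ i)\<bar>) = t" "t \<ge> 0"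
      using x by (auto simp: t_def) (simp add: l1_norm_def)
    have "(1 + t) ^ N \<le> exp t ^ N" using t(2) exp_ge_add_one_self by (intro power_mono) auto
    moreover have "norm (a (emb \<Phi> x)) \<le> \<bar>K\<bar> * exp (- c * t\<^sup>2)"
      unfolding t_def by (rule order.trans[OF bound[OF x]], intro mult_right_mono) auto
    ultimately have "(1 + t) ^ N * norm (a (emb \<Phi> x)) \<le> exp t ^ N * (\<bar>K\<bar> * exp (- c * t\<^sup>2))"
      using t(2) by (intro mult_mono) auto
    also have "\<dots> = \<bar>K\<bar> * exp (real N * t - c * t\<^sup>2)"
      by (simp add: exp_of_nat_mult[symmetric] exp_add[symmetric])
    also have "real N * t - c * t\<^sup>2 = (real N)\<^sup>2 / (4 * c) - c * (t - real N / (2 * c))\<^sup>2"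
      using c by (simp add: power2_eq_square field_simps)
    also have "\<bar>K\<bar> * exp \<dots> \<le> \<bar>K\<bar> * exp ((real N)\<^sup>2 / (4 * c))"
      using c by (intro mult_left_mono) auto
    finally show ?thesis by (simp add: t(1))
  qed
  with out show ?thesis unfolding schwartz_alg_def by blast
qed

section \<open>The functional equation\<close>

lemma lat_diff:
  assumes "lattice_embedding p q \<Phi>" "g \<in> lat p q \<Phi>" "h \<in> lat p q \<Phi>"
  shows "g - h \<in> lat p q \<Phi>"
proof -
  obtain x y where "x \<in> carrier_vec (2*p + q)" "y \<in> carrier_vec (2*p + q)" "g = emb \<Phi> x" "h = emb \<Phi> y"
    using assms unfolding lat_def by blast
  with emb_diff[OF lattice_embedding_carrier[OF assms(1)], of x y] show ?thesis
    unfolding lat_def by (auto intro!: image_eqI[where x = "x - y"])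
qed

lemma norm_cocyc: "norm (cocyc p q g h) = 1"
  by (simp add: cocyc_def)

lemma cocyc_nonzero [simp]: "cocyc p q g h \<noteq> 0"
  by (simp add: cocyc_def)

lemma quantum_theta_eq:
  assumes q: "even q" and S: "siegel p \<Omega>"
  shows "\<exists>c. \<forall>h. quantum_theta p q \<Phi> \<Omega> h = (if h \<in> lat p q \<Phi> then c * C_hat p q \<Omega> h else 0)"
proof -
  obtain c where c: "\<forall>h. l2_inner p q (gauss p q \<Omega>) (heis p q h (gauss p q \<Omega>)) = c * C_hat p q \<Omega> h"
    using l2_inner_gauss_heis[OF q S] by (elim exE)
  show ?thesis
    unfolding quantum_theta_def alg_scale_def D_inner_def c[rule_format]
    by (intro exI[of _ "of_real (sqrt (2 ^ p * det (map_mat Im \<Omega>))) * c"]) auto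
qed

text \<open>\<open>C_nonzero\<close> makes each quotient in \<open>T_hat\<close> over the lattice a
  genuine one, where division by zero would return 0. The memberships in \<open>schwartz_alg\<close>
  record that the termwise translation stays inside the algebra.\<close>

theorem theorem5:
  fixes p q :: nat and \<Phi> :: "real mat" and \<Omega> :: "complex mat"
  assumes "even q"
    and "siegel p \<Omega>"
    and "lattice_embedding p q \<Phi>"
    and C_nonzero: "\<forall>h\<in>lat p q \<Phi>. C_hat p q \<Omega> h \<noteq> 0"
  shows "quantum_theta p q \<Phi> \<Omega> \<in> schwartz_alg p q \<Phi> \<and>
    (\<forall>g\<in>lat p q \<Phi>.
       quantum_translation p q \<Omega> g (quantum_theta p q \<Phi> \<Omega>) \<in> schwartz_alg p q \<Phi> \<and>
       alg_mult p q \<Phi> (alg_scale (C_hat p q \<Omega> g) (delta g))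
         (quantum_translation p q \<Omega> g (quantum_theta p q \<Phi> \<Omega>))
       = quantum_theta p q \<Phi> \<Omega>) \<and>
    (\<forall>g\<in>lat p q \<Phi>. \<forall>h\<in>lat p q \<Phi>.
       C_hat p q \<Omega> (g + h) / (C_hat p q \<Omega> g * C_hat p q \<Omega> h)
       = T_hat p q \<Omega> g h * cocyc p q g h)"
proof -
  note L = assms(3) and nz = C_nonzero[rule_format]
  let ?C = "C_hat p q \<Omega>" and ?\<Theta> = "quantum_theta p q \<Phi> \<Omega>" and ?D = "lat p q \<Phi>"
  let ?\<tau> = "\<lambda>g. quantum_translation p q \<Omega> g ?\<Theta>"
  obtain k where "\<forall>h. ?\<Theta> h = (if h \<in> ?D then k * ?C h else 0)"
    using quantum_theta_eq[OF assms(1,2), of \<Phi>] by (elim exE)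
  note \<Theta> = this[rule_format]
  obtain K c where Kc: "K \<ge> 0" "c > 0" and bound: "\<And>x. x \<in> carrier_vec (2*p + q) \<Longrightarrow>
      norm (?C (emb \<Phi> x)) \<le> K * exp (- c * (l1_norm x)\<^sup>2)"
    using norm_C_hat_emb_le[OF assms(2) L] by blast
  have embD: "emb \<Phi> x \<in> ?D" if "x \<in> carrier_vec (2*p + q)" for x using that by (simp add: lat_def)
  \<comment> \<open>The factor \<open>?C h\<close> of the coefficient cancels against
    \<open>T_hat\<close>. What is left is the coefficient at \<open>g + h\<close>, up to factors
    that multiplication by the scaled delta at \<open>g\<close> will remove.\<close>
  have \<tau>: "?\<tau> g h = (if h \<in> ?D then k * ?C (g + h) / (?C g * cocyc p q g h) else 0)"
    if "g \<in> ?D" for g h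
    using nz[of h] by (simp add: quantum_translation_def T_hat_def \<Theta>)
  have "?\<Theta> \<in> schwartz_alg p q \<Phi>"
  proof (rule schwartz_algI_gaussian[OF Kc(2)])
    fix x :: "int vec" assume x: "x \<in> carrier_vec (2*p + q)"
    show "norm (?\<Theta> (emb \<Phi> x)) \<le> (norm k * K) * exp (- c * (l1_norm x)\<^sup>2)"
      using mult_left_mono[OF bound[OF x], of "norm k"] embD[OF x] by (simp add: \<Theta> norm_mult mult.assoc)
  qed (simp add: \<Theta>)
  moreover have "?\<tau> g \<in> schwartz_alg p q \<Phi>" if g: "g \<in> ?D" for g
  proof -
    obtain y where y: "y \<in> carrier_vec (2*p + q)" "g = emb \<Phi> y" using g by (auto simp: lat_def)
    \<comment> \<open>Shifting by \<open>y\<close> costs half of the Gaussian rate and the factor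
      \<open>exp (c * (l1_norm y)\<^sup>2)\<close>, because (a + b)^2 \<le> 2 a^2 + 2 b^2.\<close>
    let ?B = "norm k * K * exp (c * (l1_norm y)\<^sup>2) / norm (?C g)"
    show ?thesis
    proof (rule schwartz_algI_gaussian)
      show "c / 2 > 0" using Kc by simp
    next
      fix x :: "int vec" assume x: "x \<in> carrier_vec (2*p + q)"
      have "l1_norm x \<le> l1_norm (y + x) + l1_norm y"
        using x y unfolding l1_norm_def by (auto simp: sum.distrib[symmetric] intro!: sum_mono)
      then have "(l1_norm x)\<^sup>2 \<le> (l1_norm (y + x) + l1_norm y)\<^sup>2" by (intro power_mono) auto
      also have "\<dots> \<le> 2 * (l1_norm (y + x))\<^sup>2 + 2 * (l1_norm y)\<^sup>2"
        using zero_le_power2[of "l1_norm (y + x) - l1_norm y"] by (simp add: power2_eq_square algebra_simps)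
      finally have "c / 2 * (l1_norm x)\<^sup>2 \<le> c / 2 * (2 * (l1_norm (y + x))\<^sup>2 + 2 * (l1_norm y)\<^sup>2)"
        using Kc(2) by (intro mult_left_mono) auto
      then have "- c * (l1_norm (y + x))\<^sup>2 \<le> c * (l1_norm y)\<^sup>2 - c / 2 * (l1_norm x)\<^sup>2"
        by (simp add: algebra_simps)
      then have decay: "exp (- c * (l1_norm (y + x))\<^sup>2) \<le> exp (c * (l1_norm y)\<^sup>2) * exp (- (c / 2) * (l1_norm x)\<^sup>2)"
        unfolding exp_add[symmetric] by simp
      have "norm (?C (g + emb \<Phi> x)) \<le> K * exp (- c * (l1_norm (y + x))\<^sup>2)"
        using bound[of "y + x"] x y emb_add[OF lattice_embedding_carrier[OF L] y(1) x] by simp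
      also have "\<dots> \<le> K * (exp (c * (l1_norm y)\<^sup>2) * exp (- (c / 2) * (l1_norm x)\<^sup>2))"
        by (intro mult_left_mono decay Kc(1))
      finally have "norm k * norm (?C (g + emb \<Phi> x)) / norm (?C g) \<le>
          norm k * (K * (exp (c * (l1_norm y)\<^sup>2) * exp (- (c / 2) * (l1_norm x)\<^sup>2))) / norm (?C g)"
        by (intro divide_right_mono mult_left_mono) auto
      then show "norm (?\<tau> g (emb \<Phi> x)) \<le> ?B * exp (- (c / 2) * (l1_norm x)\<^sup>2)"
        using embD[OF x] by (simp add: \<tau>[OF g] norm_mult norm_divide norm_cocyc mult_ac)
    qed (simp add: \<tau>[OF g])
  qed
  moreover have "alg_mult p q \<Phi> (alg_scale (?C g) (delta g)) (?\<tau> g) = ?\<Theta>" if g: "g \<in> ?D" for g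
  proof
    fix h
    show "alg_mult p q \<Phi> (alg_scale (?C g) (delta g)) (?\<tau> g) h = ?\<Theta> h"
    proof (cases "h \<in> ?D")
      case h: True
      have hg: "h - g \<in> ?D" by (rule lat_diff[OF L h g])
      have carr: "g \<in> carrier_vec (2*p + 2*q)" "h \<in> carrier_vec (2*p + 2*q)"
        using g h emb_dim[OF lattice_embedding_carrier[OF L]] by (auto simp: lat_def)
      then have gh: "g + (h - g) = h" by (intro eq_vecI) auto
      \<comment> \<open>The delta at \<open>g\<close> reduces the convolution to the single term
        \<open>g' = g\<close>.\<close>
      have "alg_mult p q \<Phi> (alg_scale (?C g) (delta g)) (?\<tau> g) h =
          (\<Sum>\<^sub>\<infinity>g'\<in>{g}. alg_scale (?C g) (delta g) g' * ?\<tau> g (h - g') * cocyc p q g' (h - g'))"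
        using h g unfolding alg_mult_def
        by (simp only: if_True) (rule infsum_cong_neutral, auto simp: alg_scale_def delta_def)
      also have "\<dots> = ?C g * ?\<tau> g (h - g) * cocyc p q g (h - g)"
        by (simp add: alg_scale_def delta_def)
      also have "\<dots> = ?\<Theta> h" using hg h nz[OF g] by (simp add: \<tau>[OF g] gh \<Theta>)
      finally show ?thesis .
    qed (simp add: alg_mult_def \<Theta>)
  qed
  moreover have "?C (g + h) / (?C g * ?C h) = T_hat p q \<Omega> g h * cocyc p q g h" for g h
    by (simp add: T_hat_def)
  ultimately show ?thesis by blast
qed

end
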